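(* Let $\mu_1,\mu_2$ be sigma-finite positive measures on $(X,\mathcal F)$, and let $W^{(\mu_1)},W^{(\mu_2)}$ be the associated Brownian motions on the universal probability space $(\Omega,\mathcal C,\mathbb P)$, with It\^o isometries $V_{\mu_1},V_{\mu_2}$. Then for every $B\in\mathcal F^{\rm fin}(\mu_2)$ and every $A\in\mathcal F^{\rm fin}(\mu_1)$, $$V_{\mu_1}^*(W^{(\mu_2)}_B)(x)=\frac{{\rm d}\,\mathbb E(W^{(\mu_1)}_\cdot W_B^{(\mu_2)})}{{\rm d}\mu_1}(x)\quad(\mu_1\text{-a.e. }x),$$ $$V_{\mu_2}^*(W^{(\mu_1)}_A)(y)=\frac{{\rm d}\,\mathbb E(W^{(\mu_2)}_\cdot W_A^{(\mu_1)})}{{\rm d}\mu_2}(y)\quad(\mu_2\text{-a.e. }y).$$ Here the right-hand sides denote, respectively, $\nabla_{\mu_1}$ applied to the function $D\mapsto\mathbb E(W^{(\mu_1)}_DW^{(\mu_2)}_B)$ on $\mathcal F^{\rm fin}(\mu_1)$ and $\nabla_{\mu_2}$ applied to the function $D\mapsto\mathbb E(W^{(\mu_2)}_DW^{(\mu_1)}_A)$ on $\mathcal F^{\rm fin}(\mu_2)$.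
   Context: For a sigma-finite positive measure $\mu$ on $(X,\mathcal F)$, $\mathcal F^{\rm fin}(\mu)=\{A\in\mathcal F:\mu(A)<\infty\}$. $\mathfrak H(\mu)$ is the reproducing kernel Hilbert space of complex functions on $\mathcal F^{\rm fin}(\mu)$ with kernel $\mu(A\cap B)$; it is known to consist exactly of the functions $M(A)=\int_A h\,d\mu$ with $h\in\mathbf L^2(X,\mathcal F,\mu)$, and $\|M\|=\|h\|_2$. The Krein-Feller derivative $\nabla_\mu:\mathfrak H(\mu)\to\mathbf L^2(X,\mathcal F,\mu)$ sends $M$ to this (unique) $h$; $\nabla_\mu M$ is also written $\frac{{\rm d}M}{{\rm d}\mu}$. Universal Hilbert space $\mathfrak H_{(X,\mathcal F)}$: consider pairs $(f,\mu)$ with $\mu$ a sigma-finite positive measure on $(X,\mathcal F)$ and $f\in\mathbf L^2(X,\mathcal F,\mu)$; $(f_1,\mu_1)\sim(f_2,\mu_2)$ if there is a sigma-finite positive measure $\nu$ with $\mu_1\ll\nu$, $\mu_2\ll\nu$ and $f_1\sqrt{d\mu_1/d\nu}=f_2\sqrt{d\mu_2/d\nu}$ $\nu$-a.e. This is an equivalence relation; the class of $(f,\mu)$ is written $f\sqrt\mu$. With $\nu$ any common dominating measure, the linear structure is given by $\alpha f_1\sqrt{\mu_1}+\beta f_2\sqrt{\mu_2}=\big(\alpha f_1\sqrt{d\mu_1/d\nu}+\beta f_2\sqrt{d\mu_2/d\nu}\big)\sqrt\nu$ and the inner product by $\langle f_1\sqrt{\mu_1},f_2\sqrt{\mu_2}\rangle=\int_X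 f_1\overline{f_2}\sqrt{d\mu_1/d\nu}\sqrt{d\mu_2/d\nu}\,d\nu$, so that $\|f\sqrt\mu\|^2=\int_X|f|^2d\mu$; this is a Hilbert space. Universal probability space: fix an orthonormal basis $(e_i)_{i\in I}$ of $\mathfrak H_{(X,\mathcal F)}$ consisting of classes of real-valued functions, let $\Omega=\prod_{i\in I}\mathbb R$ with the cylinder sigma-algebra $\mathcal C$ and $\mathbb P$ the product of standard Gaussian measures, with coordinate functions $Z_i$. For $k\in\mathfrak H_{(X,\mathcal F)}$ put $W(k)=\sum_{i\in I}\langle k,e_i\rangle Z_i\in\mathbf L^2(\Omega,\mathcal C,\mathbb P)$. The $\mu$-Brownian motion is $W^{(\mu)}_A=W(1_A\sqrt\mu)$, $A\in\mathcal F^{\rm fin}(\mu)$ (a real centered Gaussian family with $\mathbb E(W^{(\mu)}_AW^{(\mu)}_B)=\mu(A\cap B)$). The It\^o isometry $V_\mu:\mathbf L^2(X,\mathcal F,\mu)\to\mathbf L^2(\Omega,\mathcal C,\mathbb P)$, $V_\mu f=\int_X f(x)\,dW^{(\mu)}_x$, is the unique continuous linear map with $V_\mu 1_A=W^{(\mu)}_A$ for $A\in\mathcal F^{\rm fin}(\mu)$; $V_\mu^*$ is its Hilbert space adjoint. *)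

theory Defs
  imports "HOL-Probability.Probability"
begin

section \<open>Sigma-finite measures and square integrable functions\<close>

text \<open>
  A measurable space \<open>(X, \<F>)\<close> is given by a measure \<open>S\<close> of which only \<open>space S\<close> and \<open>sets S\<close>
  are used.
\<close>

definition sfm :: "'a measure \<Rightarrow> 'a measure \<Rightarrow> bool" where
  "sfm S \<mu> \<longleftrightarrow> sets \<mu> = sets S \<and> sigma_finite_measure \<mu>"

definition Ffin :: "'a measure \<Rightarrow> 'a set set" where
  "Ffin \<mu> = {A \<in> sets \<mu>. emeasure \<mu> A < \<infinity>}"

text \<open>
  Elements of \<open>L\<^sup>2\<close> are represented by functions; equality in \<open>L\<^sup>2\<close> is equality almost everywhere.
  Inner products are linear in the first argument.
\<close>

definition L2 :: "'a measure \<Rightarrow> ('a \<Rightarrow> complex) set" where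
  "L2 M = {f \<in> borel_measurable M. integrable M (\<lambda>x. (cmod (f x))\<^sup>2)}"

definition l2inner :: "'a measure \<Rightarrow> ('a \<Rightarrow> complex) \<Rightarrow> ('a \<Rightarrow> complex) \<Rightarrow> complex" where
  "l2inner M f g = (LINT x|M. f x * cnj (g x))"

definition l2norm :: "'a measure \<Rightarrow> ('a \<Rightarrow> complex) \<Rightarrow> real" where
  "l2norm M f = sqrt (LINT x|M. (cmod (f x))\<^sup>2)"

text \<open>
  Since continuity is stated for the \<open>L\<^sup>2\<close> seminorm, such a map sends functions that
  agree a.e. to functions that agree a.e., i.e. it is a map between the \<open>L\<^sup>2\<close> spaces of classes.
\<close>

definition l2_continuous_linear ::
    "'a measure \<Rightarrow> 'b measure \<Rightarrow> (('a \<Rightarrow> complex) \<Rightarrow> ('b \<Rightarrow> complex)) \<Rightarrow> bool" where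
  "l2_continuous_linear M N V \<longleftrightarrow>
     (\<forall>f\<in>L2 M. V f \<in> L2 N) \<and>
     (\<forall>f\<in>L2 M. \<forall>g\<in>L2 M. \<forall>a b.
        AE y in N. V (\<lambda>x. a * f x + b * g x) y = a * V f y + b * V g y) \<and>
     (\<forall>F f. (\<forall>n::nat. F n \<in> L2 M) \<longrightarrow> f \<in> L2 M \<longrightarrow>
        (\<lambda>n. l2norm M (\<lambda>x. F n x - f x)) \<longlonglongrightarrow> 0 \<longrightarrow>
        (\<lambda>n. l2norm N (\<lambda>y. V (F n) y - V f y)) \<longlonglongrightarrow> 0)"

definition l2adjoint ::
    "'a measure \<Rightarrow> 'b measure \<Rightarrow> (('a \<Rightarrow> complex) \<Rightarrow> ('b \<Rightarrow> complex)) \<Rightarrow> ('b \<Rightarrow> complex) \<Rightarrow> ('a \<Rightarrow> complex)" where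
  "l2adjoint M N V w =
     (SOME h. h \<in> L2 M \<and> (\<forall>f\<in>L2 M. l2inner N (V f) w = l2inner M f h))"


section \<open>The reproducing kernel Hilbert space and the Krein-Feller derivative\<close>

text \<open>
  The Moore-Aronszajn construction. A finitely supported \<open>c\<close> stands for the combination
  \<open>\<Sum>t. c t * K(\<cdot>, t)\<close>, and the functions in the space are the pointwise limits on \<open>T\<close> of sequences of
  such combinations that are Cauchy for the norm determined by \<open>\<langle>K(\<cdot>, t), K(\<cdot>, s)\<rangle> = K(s, t)\<close>.
  Values of functions outside \<open>T\<close> are irrelevant.
\<close>

definition kcoeff :: "'t set \<Rightarrow> ('t \<Rightarrow> complex) set" where
  "kcoeff T = {c. finite {t. c t \<noteq> 0} \<and> {t. c t \<noteq> 0} \<subseteq> T}"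

definition kcomb :: "('t \<Rightarrow> 't \<Rightarrow> complex) \<Rightarrow> ('t \<Rightarrow> complex) \<Rightarrow> 't \<Rightarrow> complex" where
  "kcomb K c s = (\<Sum>t | c t \<noteq> 0. c t * K s t)"

definition knorm :: "('t \<Rightarrow> 't \<Rightarrow> complex) \<Rightarrow> ('t \<Rightarrow> complex) \<Rightarrow> real" where
  "knorm K c = sqrt (Re (\<Sum>s | c s \<noteq> 0. \<Sum>t | c t \<noteq> 0. cnj (c s) * c t * K s t))"

definition rkhs :: "'t set \<Rightarrow> ('t \<Rightarrow> 't \<Rightarrow> complex) \<Rightarrow> ('t \<Rightarrow> complex) set" where
  "rkhs T K = {f. \<exists>c. (\<forall>n::nat. c n \<in> kcoeff T) \<and>
     (\<forall>\<epsilon>>0. \<exists>N. \<forall>m\<ge>N. \<forall>n\<ge>N. knorm K (\<lambda>t. c m t - c n t) < \<epsilon>) \<and>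
     (\<forall>s\<in>T. (\<lambda>n. kcomb K (c n) s) \<longlonglongrightarrow> f s)}"

definition rkhs_measure :: "'a measure \<Rightarrow> ('a set \<Rightarrow> complex) set" where
  "rkhs_measure \<mu> = rkhs (Ffin \<mu>) (\<lambda>A B. complex_of_real (measure \<mu> (A \<inter> B)))"

definition krein_feller :: "'a measure \<Rightarrow> ('a set \<Rightarrow> complex) \<Rightarrow> ('a \<Rightarrow> complex)" where
  "krein_feller \<mu> M =
     (SOME h. h \<in> L2 \<mu> \<and> (\<forall>A\<in>Ffin \<mu>. M A = (LINT x|\<mu>. indicator A x * h x)))"


section \<open>The universal Hilbert space\<close>

definition sqrt_deriv :: "'a measure \<Rightarrow> 'a measure \<Rightarrow> 'a \<Rightarrow> complex" where
  "sqrt_deriv \<nu> \<mu> x = complex_of_real (sqrt (enn2real (RN_deriv \<nu> \<mu> x)))"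

text \<open>In the library, \<open>absolutely_continuous \<nu> \<mu>\<close> means \<open>\<mu> << \<nu>\<close>.\<close>

definition dominates :: "'a measure \<Rightarrow> 'a measure \<Rightarrow> 'a measure \<Rightarrow> 'a measure \<Rightarrow> bool" where
  "dominates S \<nu> \<mu>1 \<mu>2 \<longleftrightarrow>
     sfm S \<nu> \<and> absolutely_continuous \<nu> \<mu>1 \<and> absolutely_continuous \<nu> \<mu>2"

definition upairs :: "'a measure \<Rightarrow> (('a \<Rightarrow> complex) \<times> 'a measure) set" where
  "upairs S = {(f, \<mu>). sfm S \<mu> \<and> f \<in> L2 \<mu>}"

definition uequiv ::
    "'a measure \<Rightarrow> ((('a \<Rightarrow> complex) \<times> 'a measure) \<times> (('a \<Rightarrow> complex) \<times> 'a measure)) set" where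
  "uequiv S = {((f1, \<mu>1), (f2, \<mu>2)). (f1, \<mu>1) \<in> upairs S \<and> (f2, \<mu>2) \<in> upairs S \<and>
     (\<exists>\<nu>. dominates S \<nu> \<mu>1 \<mu>2 \<and>
        (AE x in \<nu>. f1 x * sqrt_deriv \<nu> \<mu>1 x = f2 x * sqrt_deriv \<nu> \<mu>2 x))}"

type_synonym 'a uvec = "(('a \<Rightarrow> complex) \<times> 'a measure) set"

definition uspace :: "'a measure \<Rightarrow> 'a uvec set" where
  "uspace S = upairs S // uequiv S"

text \<open>\<open>uclass S f \<mu>\<close> is the vector \<open>f \<surd>\<mu>\<close>.\<close>

definition uclass :: "'a measure \<Rightarrow> ('a \<Rightarrow> complex) \<Rightarrow> 'a measure \<Rightarrow> 'a uvec" where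
  "uclass S f \<mu> = uequiv S `` {(f, \<mu>)}"

definition ulincomb :: "'a measure \<Rightarrow> complex \<Rightarrow> 'a uvec \<Rightarrow> complex \<Rightarrow> 'a uvec \<Rightarrow> 'a uvec" where
  "ulincomb S \<alpha> k \<beta> l = (THE m. \<exists>f1 \<mu>1 f2 \<mu>2 \<nu>.
     (f1, \<mu>1) \<in> k \<and> (f2, \<mu>2) \<in> l \<and> dominates S \<nu> \<mu>1 \<mu>2 \<and>
     m = uclass S (\<lambda>x. \<alpha> * (f1 x * sqrt_deriv \<nu> \<mu>1 x) + \<beta> * (f2 x * sqrt_deriv \<nu> \<mu>2 x)) \<nu>)"

definition uinner :: "'a measure \<Rightarrow> 'a uvec \<Rightarrow> 'a uvec \<Rightarrow> complex" where
  "uinner S k l = (THE c. \<exists>f1 \<mu>1 f2 \<mu>2 \<nu>.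
     (f1, \<mu>1) \<in> k \<and> (f2, \<mu>2) \<in> l \<and> dominates S \<nu> \<mu>1 \<mu>2 \<and>
     c = (LINT x|\<nu>. f1 x * cnj (f2 x) * sqrt_deriv \<nu> \<mu>1 x * sqrt_deriv \<nu> \<mu>2 x))"

definition unorm :: "'a measure \<Rightarrow> 'a uvec \<Rightarrow> real" where
  "unorm S k = sqrt (Re (uinner S k k))"

definition uzero :: "'a measure \<Rightarrow> 'a uvec" where
  "uzero S = uclass S (\<lambda>_. 0) (null_measure S)"

inductive_set uspan :: "'a measure \<Rightarrow> 'a uvec set \<Rightarrow> 'a uvec set" for S E where
  zero: "uzero S \<in> uspan S E"
| add: "k \<in> uspan S E \<Longrightarrow> v \<in> E \<Longrightarrow> ulincomb S 1 k c v \<in> uspan S E"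

definition orthonormal_basis :: "'a measure \<Rightarrow> 'i set \<Rightarrow> ('i \<Rightarrow> 'a uvec) \<Rightarrow> bool" where
  "orthonormal_basis S I e \<longleftrightarrow>
     (\<forall>i\<in>I. e i \<in> uspace S) \<and>
     (\<forall>i\<in>I. \<forall>j\<in>I. uinner S (e i) (e j) = (if i = j then 1 else 0)) \<and>
     (\<forall>k\<in>uspace S. \<forall>\<epsilon>>0. \<exists>l\<in>uspan S (e ` I). unorm S (ulincomb S 1 k (-1) l) < \<epsilon>)"

definition real_class :: "'a measure \<Rightarrow> 'a uvec \<Rightarrow> bool" where
  "real_class S k \<longleftrightarrow>
     (\<exists>f \<mu>. (f, \<mu>) \<in> upairs S \<and> (\<forall>x\<in>space S. f x \<in> \<real>) \<and> k = uclass S f \<mu>)"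


section \<open>The universal probability space, Brownian motions and Ito isometries\<close>

definition gauss :: "'i set \<Rightarrow> ('i \<Rightarrow> real) measure" where
  "gauss I = (\<Pi>\<^sub>M i\<in>I. density lborel (\<lambda>x. ennreal (std_normal_density x)))"

text \<open>
  The series defining \<open>W\<close> is the limit in \<open>L\<^sup>2\<close> of the net of its finite partial sums; \<open>W S I e k\<close> is
  a version of that limit.
\<close>

definition W :: "'a measure \<Rightarrow> 'i set \<Rightarrow> ('i \<Rightarrow> 'a uvec) \<Rightarrow> 'a uvec \<Rightarrow> ('i \<Rightarrow> real) \<Rightarrow> complex" where
  "W S I e k = (SOME w. w \<in> L2 (gauss I) \<and>
     ((\<lambda>J. l2norm (gauss I) (\<lambda>\<omega>. (\<Sum>i\<in>J. uinner S k (e i) * complex_of_real (\<omega> i)) - w \<omega>))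
        \<longlongrightarrow> 0) (finite_subsets_at_top I))"

definition brownian ::
    "'a measure \<Rightarrow> 'i set \<Rightarrow> ('i \<Rightarrow> 'a uvec) \<Rightarrow> 'a measure \<Rightarrow> 'a set \<Rightarrow> ('i \<Rightarrow> real) \<Rightarrow> complex" where
  "brownian S I e \<mu> A = W S I e (uclass S (indicator A) \<mu>)"

definition ito ::
    "'a measure \<Rightarrow> 'i set \<Rightarrow> ('i \<Rightarrow> 'a uvec) \<Rightarrow> 'a measure \<Rightarrow>
       ('a \<Rightarrow> complex) \<Rightarrow> (('i \<Rightarrow> real) \<Rightarrow> complex)" where
  "ito S I e \<mu> = (SOME V. l2_continuous_linear \<mu> (gauss I) V \<and>
     (\<forall>A\<in>Ffin \<mu>. AE \<omega> in gauss I. V (indicator A) \<omega> = brownian S I e \<mu> A \<omega>))"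

end

theory Submission
  imports Defs
begin

text \<open>
  The white noise of a vector \<open>k\<close> is an \<open>L\<^sup>2\<close> limit of sums \<open>\<Sum>i\<in>J. \<langle>k, e i\<rangle> Z i\<close>, so by Bessel's
  inequality \<open>f \<mapsto> W (f \<surd>\<mu>)\<close> is a contraction, and it witnesses the existence of the Ito map. For any
  continuous linear \<open>V\<close> with \<open>V 1\<^sub>D = W\<^sub>D\<close>, the value \<open>h\<close> of its adjoint at \<open>w = W\<^sub>B\<close>, which the
  Riesz representation theorem provides, satisfies \<open>\<integral>\<^sub>D cnj h d\<mu> = \<langle>V 1\<^sub>D, w\<rangle> = E (W\<^sub>D W\<^sub>B)\<close>. This is
  real because the basis consists of classes of real functions, so \<open>h\<close> itself is the Krein-Feller
  derivative of \<open>D \<mapsto> E (W\<^sub>D W\<^sub>B)\<close>: an \<open>L\<^sup>2\<close> function is determined by its integrals over the sets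
  of finite measure.
\<close>

section \<open>Square integrable functions\<close>

text \<open>Vectors of the universal space carry different measures. Lifted to a common dominating
  measure they become ordinary square integrable functions, and inner products are computed there.
  Such a measure is built for finitely many vectors at a time, because an uncountable orthonormal
  family may admit no sigma-finite dominating measure. Bessel's inequality is therefore proved on
  finite index sets, and the Gaussian series converges along the net of these sets.
  \<open>W\<close>, \<open>ito\<close>, \<open>l2adjoint\<close> and \<open>krein_feller\<close> are
  values of the choice operator, so an existence proof must precede any use of their properties, and
  linearity is available only almost everywhere. Membership in \<open>rkhs_measure\<close> says that
  the correlation function lies in the domain of the derivative. It holds because step functions
  approximating \<open>h\<close> and kernel combinations approximating the integrals of
  \<open>h\<close> share their coefficients.\<close>

lemma L2_measurable: "f \<in> L2 M \<Longrightarrow> f \<in> borel_measurable M"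
  by (simp add: L2_def)

lemma L2_integrable_sq: "f \<in> L2 M \<Longrightarrow> integrable M (\<lambda>x. (cmod (f x))\<^sup>2)"
  by (simp add: L2_def)

lemma borel_measurable_cnj [measurable (raw)]:
  "f \<in> borel_measurable M \<Longrightarrow> (\<lambda>x. cnj (f x)) \<in> borel_measurable M"
  by (rule measurable_compose[OF _ borel_measurable_continuous_onI]) (simp_all add: continuous_on_cnj)

lemma L2_integrable_mult:
  assumes "f \<in> L2 M" "g \<in> L2 M"
  shows "integrable M (\<lambda>x. f x * cnj (g x))"
proof (rule Bochner_Integration.integrable_bound)
  show "integrable M (\<lambda>x. (cmod (f x))\<^sup>2 + (cmod (g x))\<^sup>2)"
    using assms by (simp add: L2_integrable_sq)
  show "(\<lambda>x. f x * cnj (g x)) \<in> borel_measurable M"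
    using assms[THEN L2_measurable] by measurable
  have "cmod (f x * cnj (g x)) \<le> (cmod (f x))\<^sup>2 + (cmod (g x))\<^sup>2" for x
  proof -
    have "0 \<le> cmod (f x) * cmod (g x)" by simp
    then show ?thesis
      using sum_squares_bound[of "cmod (f x)" "cmod (g x)"]
      unfolding norm_mult complex_mod_cnj by linarith
  qed
  then show "AE x in M. norm (f x * cnj (g x)) \<le> norm ((cmod (f x))\<^sup>2 + (cmod (g x))\<^sup>2)"
    by simp
qed

lemma L2_lincomb:
  assumes "f \<in> L2 M" "g \<in> L2 M"
  shows "(\<lambda>x. a * f x + b * g x) \<in> L2 M"
proof -
  note [measurable] = assms[THEN L2_measurable]
  have "(cmod (a * f x + b * g x))\<^sup>2 \<le> 2 * (cmod a)\<^sup>2 * (cmod (f x))\<^sup>2 + 2 * (cmod b)\<^sup>2 * (cmod (g x))\<^sup>2" for x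
  proof -
    have "(cmod (a * f x + b * g x))\<^sup>2 \<le> (cmod (a * f x) + cmod (b * g x))\<^sup>2"
      by (intro power_mono norm_triangle_ineq) auto
    also have "\<dots> \<le> 2 * (cmod (a * f x))\<^sup>2 + 2 * (cmod (b * g x))\<^sup>2"
      using sum_squares_bound[of "cmod (a * f x)" "cmod (b * g x)"] by (simp add: power2_sum)
    finally show ?thesis by (simp add: norm_mult power_mult_distrib)
  qed
  then have "AE x in M. norm ((cmod (a * f x + b * g x))\<^sup>2)
      \<le> norm (2 * (cmod a)\<^sup>2 * (cmod (f x))\<^sup>2 + 2 * (cmod b)\<^sup>2 * (cmod (g x))\<^sup>2)"
    unfolding real_norm_def abs_power2 by (intro AE_I2 order_trans[OF _ abs_ge_self])
  then have "integrable M (\<lambda>x. (cmod (a * f x + b * g x))\<^sup>2)"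
    by (rule Bochner_Integration.integrable_bound[rotated 2])
       (use assms[THEN L2_integrable_sq] in simp_all)
  then show ?thesis by (simp add: L2_def)
qed

lemma L2_zero: "(\<lambda>_. 0) \<in> L2 M"
  by (simp add: L2_def)

lemma L2_scale: "f \<in> L2 M \<Longrightarrow> (\<lambda>x. a * f x) \<in> L2 M"
  using L2_lincomb[of f M f a 0] by simp

lemma L2_add: "f \<in> L2 M \<Longrightarrow> g \<in> L2 M \<Longrightarrow> (\<lambda>x. f x + g x) \<in> L2 M"
  using L2_lincomb[of f M g 1 1] by simp

lemma L2_diff: "f \<in> L2 M \<Longrightarrow> g \<in> L2 M \<Longrightarrow> (\<lambda>x. f x - g x) \<in> L2 M"
  using L2_lincomb[of f M g 1 "-1"] by simp

lemma L2_cnj: "f \<in> L2 M \<Longrightarrow> (\<lambda>x. cnj (f x)) \<in> L2 M"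
  by (simp add: L2_def borel_measurable_cnj)

lemma L2_sum:
  "(\<And>i. i \<in> J \<Longrightarrow> f i \<in> L2 M) \<Longrightarrow> (\<lambda>x. \<Sum>i\<in>J. c i * f i x) \<in> L2 M"
  by (induction J rule: infinite_finite_induct)
     (auto simp: L2_zero intro!: L2_add L2_scale)

lemma L2_indicator: "A \<in> Ffin M \<Longrightarrow> indicator A \<in> L2 M"
proof -
  have "(\<lambda>x. (cmod (indicator A x))\<^sup>2) = (indicator A :: 'a \<Rightarrow> real)"
    by (auto simp: indicator_def)
  then show "A \<in> Ffin M \<Longrightarrow> indicator A \<in> L2 M"
    by (simp add: L2_def Ffin_def borel_measurable_indicator)
qed

section \<open>Inner product, seminorm and convergence in mean square\<close>

lemma l2inner_add_left:
  assumes "f \<in> L2 M" "g \<in> L2 M" "h \<in> L2 M"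
  shows "l2inner M (\<lambda>x. f x + g x) h = l2inner M f h + l2inner M g h"
  using L2_integrable_mult[OF assms(1,3)] L2_integrable_mult[OF assms(2,3)]
  by (simp add: l2inner_def ring_distribs)

lemma l2inner_scale_left: "l2inner M (\<lambda>x. a * f x) h = a * l2inner M f h"
  by (simp add: l2inner_def mult.assoc)

lemma l2inner_commute: "l2inner M g f = cnj (l2inner M f g)"
  unfolding l2inner_def by (subst Bochner_Integration.integral_cnj[symmetric]) (simp add: mult.commute)

lemma l2inner_lincomb_left:
  assumes "f \<in> L2 M" "g \<in> L2 M" "h \<in> L2 M"
  shows "l2inner M (\<lambda>x. a * f x + b * g x) h = a * l2inner M f h + b * l2inner M g h"
  using assms by (simp add: l2inner_add_left l2inner_scale_left L2_scale)

lemma l2inner_diff_left: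
  assumes "f \<in> L2 M" "g \<in> L2 M" "h \<in> L2 M"
  shows "l2inner M (\<lambda>x. f x - g x) h = l2inner M f h - l2inner M g h"
  using l2inner_lincomb_left[OF assms, of 1 "-1"] by simp

lemma l2inner_lincomb_right:
  assumes "f \<in> L2 M" "g \<in> L2 M" "h \<in> L2 M"
  shows "l2inner M h (\<lambda>x. a * f x + b * g x) = cnj a * l2inner M h f + cnj b * l2inner M h g"
  by (simp add: l2inner_commute[of M h] l2inner_lincomb_left assms)

lemma l2inner_sum_left:
  assumes "\<And>i. i \<in> J \<Longrightarrow> f i \<in> L2 M" "h \<in> L2 M"
  shows "l2inner M (\<lambda>x. \<Sum>i\<in>J. c i * f i x) h = (\<Sum>i\<in>J. c i * l2inner M (f i) h)"
  using assms(1)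
proof (induction J rule: infinite_finite_induct)
  case (insert i J)
  then show ?case
    using l2inner_lincomb_left[of "f i" M "\<lambda>x. \<Sum>i\<in>J. c i * f i x" h "c i" 1] assms(2)
    by (simp add: L2_sum)
qed (simp_all add: l2inner_def)

lemma l2norm_nonneg: "0 \<le> l2norm M f"
  by (simp add: l2norm_def)

lemma l2norm_sq: "(l2norm M f)\<^sup>2 = (LINT x|M. (cmod (f x))\<^sup>2)"
  by (simp add: l2norm_def)

lemma l2inner_self: "l2inner M f f = complex_of_real ((l2norm M f)\<^sup>2)"
  unfolding l2norm_sq l2inner_def complex_norm_square[symmetric]
  by (rule integral_complex_of_real)

lemma l2norm_scale: "l2norm M (\<lambda>x. a * f x) = cmod a * l2norm M f"
  by (simp add: l2norm_def norm_mult power_mult_distrib real_sqrt_mult)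

text \<open>This single expansion underlies the Cauchy-Schwarz and triangle inequalities, the
  parallelogram identity and first variation in the Riesz theorem, and Bessel's inequality.\<close>

lemma l2norm_lincomb_sq:
  assumes "f \<in> L2 M" "g \<in> L2 M"
  shows "(l2norm M (\<lambda>x. a * f x + b * g x))\<^sup>2 =
    (cmod a)\<^sup>2 * (l2norm M f)\<^sup>2 + 2 * Re (a * cnj b * l2inner M f g) + (cmod b)\<^sup>2 * (l2norm M g)\<^sup>2"
proof -
  have "complex_of_real ((l2norm M (\<lambda>x. a * f x + b * g x))\<^sup>2) =
    a * cnj a * l2inner M f f + (a * cnj b * l2inner M f g + cnj (a * cnj b * l2inner M f g))
      + b * cnj b * l2inner M g g"
    unfolding l2inner_self[symmetric]
    using assms l2inner_commute[of M g f]
    by (simp add: l2inner_lincomb_left l2inner_lincomb_right L2_lincomb algebra_simps)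
  then have "complex_of_real ((l2norm M (\<lambda>x. a * f x + b * g x))\<^sup>2) = complex_of_real
     ((cmod a)\<^sup>2 * (l2norm M f)\<^sup>2 + 2 * Re (a * cnj b * l2inner M f g) + (cmod b)\<^sup>2 * (l2norm M g)\<^sup>2)"
    unfolding l2inner_self complex_add_cnj complex_norm_square[symmetric] by simp
  then show ?thesis unfolding of_real_eq_iff .
qed

lemma l2_Cauchy_Schwarz:
  assumes "f \<in> L2 M" "g \<in> L2 M"
  shows "cmod (l2inner M f g) \<le> l2norm M f * l2norm M g"
proof -
  define a where "a = l2inner M f g"
  \<comment> \<open>The factor \<open>a\<close> in the subtracted multiple t * \<open>a\<close> *
    \<open>g\<close> cancels the phase of the inner product, so the squared norm is a real quadratic
    in \<open>t\<close>.\<close>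
  have *: "0 \<le> (l2norm M f)\<^sup>2 - 2 * t * (cmod a)\<^sup>2 + t\<^sup>2 * (cmod a)\<^sup>2 * (l2norm M g)\<^sup>2" for t :: real
  proof -
    have "0 \<le> (l2norm M (\<lambda>x. 1 * f x + (- (complex_of_real t * a)) * g x))\<^sup>2"
      by simp
    also have "\<dots> = (l2norm M f)\<^sup>2 + 2 * Re (- (complex_of_real t * (a * cnj a))) + t\<^sup>2 * (cmod a)\<^sup>2 * (l2norm M g)\<^sup>2"
      unfolding l2norm_lincomb_sq[OF assms]
      by (simp add: a_def norm_mult power_mult_distrib mult_ac)
    also have "Re (- (complex_of_real t * (a * cnj a))) = - t * (cmod a)\<^sup>2"
      unfolding complex_norm_square[symmetric] by simp
    finally show ?thesis by (simp add: algebra_simps)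
  qed
  show ?thesis
  proof (cases "l2norm M g = 0")
    case True
    have "a = 0"
    proof (rule ccontr)
      assume "a \<noteq> 0"
      then have "(cmod a)\<^sup>2 > 0" by simp
      then show False
        \<comment> \<open>With \<open>g\<close> of norm 0 the quadratic degenerates to an affine
          function, which is negative at this \<open>t\<close> unless \<open>a\<close> is 0.\<close>
        using *[of "((l2norm M f)\<^sup>2 + 1) / (cmod a)\<^sup>2"] True zero_le_power2[of "l2norm M f"]
        by simp
    qed
    then show ?thesis using True by (simp add: a_def)
  next
    case False
    then have g: "(l2norm M g)\<^sup>2 > 0" by simp
    have "0 \<le> (l2norm M f)\<^sup>2 - (cmod a)\<^sup>2 / (l2norm M g)\<^sup>2"
    proof -
      have "(1 / G)\<^sup>2 * A * G = A / G" if "G > 0" for A G :: real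
        using that by (simp add: power2_eq_square)
      from this[OF g, of "(cmod a)\<^sup>2"] show ?thesis
        \<comment> \<open>For nonzero \<open>a\<close> this value of \<open>t\<close> minimizes the
          quadratic.\<close>
        using *[of "1 / (l2norm M g)\<^sup>2"] by simp
    qed
    then have "(cmod a)\<^sup>2 \<le> (l2norm M f * l2norm M g)\<^sup>2"
      using g by (simp add: power_mult_distrib field_simps)
    then show ?thesis
      unfolding a_def[symmetric] by (rule power2_le_imp_le) (simp add: l2norm_nonneg)
  qed
qed

lemma l2norm_triangle:
  assumes "f \<in> L2 M" "g \<in> L2 M"
  shows "l2norm M (\<lambda>x. f x + g x) \<le> l2norm M f + l2norm M g"
proof (rule power2_le_imp_le)
  have "(l2norm M (\<lambda>x. f x + g x))\<^sup>2 = (l2norm M f)\<^sup>2 + 2 * Re (l2inner M f g) + (l2norm M g)\<^sup>2"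
    using l2norm_lincomb_sq[OF assms, of 1 1] by simp
  also have "\<dots> \<le> (l2norm M f)\<^sup>2 + 2 * (l2norm M f * l2norm M g) + (l2norm M g)\<^sup>2"
    using l2_Cauchy_Schwarz[OF assms] complex_Re_le_cmod[of "l2inner M f g"] by linarith
  finally show "(l2norm M (\<lambda>x. f x + g x))\<^sup>2 \<le> (l2norm M f + l2norm M g)\<^sup>2"
    by (simp add: power2_sum)
qed (simp add: l2norm_nonneg)

lemma l2norm_minus_commute: "l2norm M (\<lambda>x. f x - g x) = l2norm M (\<lambda>x. g x - f x)"
  by (simp add: l2norm_def norm_minus_commute)

lemma l2norm_triangle_diff:
  assumes "f \<in> L2 M" "g \<in> L2 M" "h \<in> L2 M"
  shows "l2norm M (\<lambda>x. f x - h x) \<le> l2norm M (\<lambda>x. f x - g x) + l2norm M (\<lambda>x. g x - h x)"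
  using l2norm_triangle[of "\<lambda>x. f x - g x" M "\<lambda>x. g x - h x"] assms by (simp add: L2_diff)

lemma l2norm_eq_0_iff:
  assumes "f \<in> L2 M"
  shows "l2norm M f = 0 \<longleftrightarrow> (AE x in M. f x = 0)"
  using integral_nonneg_eq_0_iff_AE[OF L2_integrable_sq[OF assms]]
  by (simp add: l2norm_def)

lemma l2norm_cong_AE:
  assumes "f \<in> borel_measurable M" "g \<in> borel_measurable M" "AE x in M. f x = g x"
  shows "l2norm M f = l2norm M g"
  unfolding l2norm_def using assms by (intro arg_cong[of _ _ sqrt] integral_cong_AE) auto

lemma l2inner_cong_AE:
  assumes "f \<in> borel_measurable M" "f' \<in> borel_measurable M" "AE x in M. f x = f' x"
    "g \<in> borel_measurable M" "g' \<in> borel_measurable M" "AE x in M. g x = g' x"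
  shows "l2inner M f g = l2inner M f' g'"
  unfolding l2inner_def using assms by (intro integral_cong_AE) auto

lemma l2inner_tendsto:
  assumes "\<And>J. F J \<in> L2 M" "f \<in> L2 M" "g \<in> L2 M"
    and lim: "((\<lambda>J. l2norm M (\<lambda>x. F J x - f x)) \<longlongrightarrow> 0) net"
  shows "((\<lambda>J. l2inner M (F J) g) \<longlongrightarrow> l2inner M f g) net"
proof -
  have "((\<lambda>J. l2norm M (\<lambda>x. F J x - f x) * l2norm M g) \<longlongrightarrow> 0) net"
    using tendsto_mult_right[OF lim, of "l2norm M g"] by simp
  then have "((\<lambda>J. l2inner M (F J) g - l2inner M f g) \<longlongrightarrow> 0) net"
    by (rule Lim_null_comparison[rotated])
       (use assms in \<open>auto simp: l2inner_diff_left[symmetric] intro!: always_eventually l2_Cauchy_Schwarz L2_diff\<close>)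
  then show ?thesis by (simp add: LIM_zero_iff)
qed

text \<open>Membership is required only eventually: along the net of finite sets, the partial sums
  of the Gaussian series are known to be square integrable for index sets inside
  \<open>I\<close>.\<close>

lemma l2norm_tendsto:
  assumes F: "\<forall>\<^sub>F J in net. F J \<in> L2 M" and f: "f \<in> L2 M"
    and lim: "((\<lambda>J. l2norm M (\<lambda>x. F J x - f x)) \<longlongrightarrow> 0) net"
  shows "((\<lambda>J. l2norm M (F J)) \<longlongrightarrow> l2norm M f) net"
proof -
  have "\<bar>l2norm M (F J) - l2norm M f\<bar> \<le> l2norm M (\<lambda>x. F J x - f x)" if "F J \<in> L2 M" for J
    using l2norm_triangle[of "\<lambda>x. F J x - f x" M f] l2norm_triangle[of "\<lambda>x. f x - F J x" M "F J"]
      l2norm_minus_commute[of M "F J" f] that f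
    by (simp add: L2_diff)
  then have "((\<lambda>J. l2norm M (F J) - l2norm M f) \<longlongrightarrow> 0) net"
    using F by (intro Lim_null_comparison[OF _ lim]) (auto elim: eventually_mono)
  then show ?thesis by (simp add: LIM_zero_iff)
qed

lemma l2_limit_unique:
  assumes F: "\<forall>\<^sub>F J in net. F J \<in> L2 M" and "f \<in> L2 M" "g \<in> L2 M" "net \<noteq> bot"
    and f: "((\<lambda>J. l2norm M (\<lambda>x. F J x - f x)) \<longlongrightarrow> 0) net"
    and g: "((\<lambda>J. l2norm M (\<lambda>x. F J x - g x)) \<longlongrightarrow> 0) net"
  shows "AE x in M. f x = g x"
proof -
  have "l2norm M (\<lambda>x. f x - g x) \<le> 0"
  proof (rule tendsto_lowerbound)
    show "((\<lambda>J. l2norm M (\<lambda>x. F J x - f x) + l2norm M (\<lambda>x. F J x - g x)) \<longlongrightarrow> 0) net"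
      using tendsto_add[OF f g] by simp
    have "l2norm M (\<lambda>x. f x - g x) \<le> l2norm M (\<lambda>x. F J x - f x) + l2norm M (\<lambda>x. F J x - g x)"
      if "F J \<in> L2 M" for J
      using l2norm_triangle_diff[OF assms(2) that assms(3)] l2norm_minus_commute[of M f "F J"] by linarith
    with F show "\<forall>\<^sub>F J in net. l2norm M (\<lambda>x. f x - g x) \<le> l2norm M (\<lambda>x. F J x - f x) + l2norm M (\<lambda>x. F J x - g x)"
      by (rule eventually_mono)
  qed fact
  then have "l2norm M (\<lambda>x. f x - g x) = 0"
    using l2norm_nonneg[of M "\<lambda>x. f x - g x"] by linarith
  then show ?thesis using assms(2,3) by (simp add: l2norm_eq_0_iff L2_diff)
qed

section \<open>Completeness and the Riesz representation theorem\<close>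

text \<open>The squared increments have integrals at most 4^(-n). Weighted by 2^n they still have a
  finite total integral, so the weighted series is finite almost everywhere, and this forces
  absolute convergence of the telescoping series.\<close>

lemma l2_fast_Cauchy_limit:
  assumes F: "\<And>n. F n \<in> L2 M"
    and fast: "\<And>n. l2norm M (\<lambda>x. F (Suc n) x - F n x) \<le> (1/2) ^ n"
  shows "AE x in M. convergent (\<lambda>n. F n x)"
proof -
  note [measurable] = F[THEN L2_measurable]
  define d where "d n x = F (Suc n) x - F n x" for n x
  have d: "d n \<in> L2 M" for n unfolding d_def using F by (simp add: L2_diff)
  note [measurable] = d[THEN L2_measurable]
  have bound: "(\<integral>\<^sup>+x. ennreal (2 ^ n * (cmod (d n x))\<^sup>2) \<partial>M) \<le> ennreal ((1/2) ^ n)" for n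
  proof -
    have "(\<integral>\<^sup>+x. ennreal (2 ^ n * (cmod (d n x))\<^sup>2) \<partial>M) = ennreal (2 ^ n * (l2norm M (d n))\<^sup>2)"
      using L2_integrable_sq[OF d] by (subst nn_integral_eq_integral) (auto simp: l2norm_sq)
    also have "\<dots> \<le> ennreal (2 ^ n * ((1/2) ^ n)\<^sup>2)"
      using fast[of n] by (intro ennreal_leI mult_left_mono power_mono) (auto simp: d_def[abs_def] l2norm_nonneg)
    also have "2 ^ n * ((1/2) ^ n)\<^sup>2 = (1/2 :: real) ^ n"
      by (simp add: power2_eq_square power_divide)
    finally show ?thesis .
  qed
  have "(\<integral>\<^sup>+x. (\<Sum>n. ennreal (2 ^ n * (cmod (d n x))\<^sup>2)) \<partial>M) = (\<Sum>n. \<integral>\<^sup>+x. ennreal (2 ^ n * (cmod (d n x))\<^sup>2) \<partial>M)"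
    by (intro nn_integral_suminf) measurable
  also have "\<dots> \<le> (\<Sum>n. ennreal ((1/2) ^ n))"
    using bound by (intro suminf_le) auto
  also have "\<dots> = ennreal (1 / (1 - 1/2))"
    by (intro suminf_ennreal_eq geometric_sums) auto
  also have "\<dots> < \<infinity>" by simp
  finally have "AE x in M. (\<Sum>n. ennreal (2 ^ n * (cmod (d n x))\<^sup>2)) \<noteq> \<infinity>"
    by (intro nn_integral_PInf_AE) (auto simp: less_top)
  then show ?thesis
  proof eventually_elim
    case (elim x)
    then have "summable (\<lambda>n. 2 ^ n * (cmod (d n x))\<^sup>2)"
      by (intro summable_suminf_not_top) auto
    then have "summable (\<lambda>n. (1/2) ^ n + 2 ^ n * (cmod (d n x))\<^sup>2)"
      by (intro summable_add summable_geometric) auto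
    \<comment> \<open>AM-GM with weight \<open>2 ^ n\<close> replaces the Minkowski inequality for infinite sums\<close>
    moreover have "cmod (d n x) \<le> (1/2) ^ n + 2 ^ n * (cmod (d n x))\<^sup>2" for n
    proof -
      define u :: real where "u = 2 ^ n"
      have u: "u > 0" by (simp add: u_def)
      have "0 \<le> (1 / u) * (1 - u * cmod (d n x) / 2)\<^sup>2 + 3/4 * (u * (cmod (d n x))\<^sup>2)"
        using u by (intro add_nonneg_nonneg mult_nonneg_nonneg) auto
      also have "\<dots> = 1 / u - cmod (d n x) + u * (cmod (d n x))\<^sup>2"
        using u by (simp add: power2_eq_square field_simps)
      finally show ?thesis by (simp add: u_def power_divide)
    qed
    ultimately have "summable (\<lambda>n. d n x)"
      by (rule summable_comparison_test'[where N = 0])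
    then have "convergent (\<lambda>n. \<Sum>k<n. F (Suc k) x - F k x)"
      by (simp add: summable_iff_convergent d_def)
    then have "convergent (\<lambda>n. (F n x - F 0 x) + F 0 x)"
      unfolding sum_lessThan_telescope[of "\<lambda>n. F n x"] by (intro convergent_add convergent_const)
    then show ?case by simp
  qed
qed

text \<open>Fatou's lemma turns a bound along the sequence into a bound for the pointwise limit
  without any integrable majorant. Square integrability of \<open>f\<close> then follows from that
  of \<open>g\<close> and \<open>g\<close> - \<open>f\<close>.\<close>

lemma l2_AE_limit:
  assumes F: "\<And>n. F n \<in> L2 M" and g: "g \<in> L2 M" and f [measurable]: "f \<in> borel_measurable M"
    and lim: "AE x in M. (\<lambda>n. F n x) \<longlonglongrightarrow> f x"
    and bound: "\<forall>\<^sub>F n in sequentially. l2norm M (\<lambda>x. g x - F n x) \<le> \<epsilon>"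
  shows "f \<in> L2 M" "l2norm M (\<lambda>x. g x - f x) \<le> \<epsilon>"
proof -
  note [measurable] = F[THEN L2_measurable] g[THEN L2_measurable]
  from bound have "\<epsilon> \<ge> 0"
    using l2norm_nonneg by (meson eventually_sequentially order_trans order_refl)
  have "(\<integral>\<^sup>+x. ennreal ((cmod (g x - f x))\<^sup>2) \<partial>M)
      = (\<integral>\<^sup>+x. liminf (\<lambda>n. ennreal ((cmod (g x - F n x))\<^sup>2)) \<partial>M)"
  proof (rule nn_integral_cong_AE)
    show "AE x in M. ennreal ((cmod (g x - f x))\<^sup>2) = liminf (\<lambda>n. ennreal ((cmod (g x - F n x))\<^sup>2))"
      using lim
    proof eventually_elim
      case (elim x)
      then have "(\<lambda>n. ennreal ((cmod (g x - F n x))\<^sup>2)) \<longlonglongrightarrow> ennreal ((cmod (g x - f x))\<^sup>2)"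
        by (intro tendsto_intros)
      then show ?case by (intro lim_imp_Liminf[symmetric]) auto
    qed
  qed
  also have "\<dots> \<le> liminf (\<lambda>n. \<integral>\<^sup>+x. ennreal ((cmod (g x - F n x))\<^sup>2) \<partial>M)"
    by (intro nn_integral_liminf) measurable
  also have "\<dots> = liminf (\<lambda>n. ennreal ((l2norm M (\<lambda>x. g x - F n x))\<^sup>2))"
    using L2_integrable_sq[OF L2_diff[OF g F]] by (subst nn_integral_eq_integral) (auto simp: l2norm_sq)
  also have "\<dots> \<le> limsup (\<lambda>n. ennreal ((l2norm M (\<lambda>x. g x - F n x))\<^sup>2))"
    by (intro Liminf_le_Limsup) simp
  also have "\<dots> \<le> ennreal (\<epsilon>\<^sup>2)"
    using bound by (intro Limsup_bounded) (auto elim!: eventually_mono intro!: ennreal_leI power_mono l2norm_nonneg)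
  finally have le: "(\<integral>\<^sup>+x. ennreal ((cmod (g x - f x))\<^sup>2) \<partial>M) \<le> ennreal (\<epsilon>\<^sup>2)" .
  have int: "integrable M (\<lambda>x. (cmod (g x - f x))\<^sup>2)"
    by (rule integrableI_nonneg) (use le in \<open>auto simp: le_less_trans\<close>)
  then have gf: "(\<lambda>x. g x - f x) \<in> L2 M" by (simp add: L2_def)
  from L2_diff[OF g gf] show "f \<in> L2 M" by simp
  have "ennreal ((l2norm M (\<lambda>x. g x - f x))\<^sup>2) \<le> ennreal (\<epsilon>\<^sup>2)"
    using le int by (subst (asm) nn_integral_eq_integral) (auto simp: l2norm_sq)
  then show "l2norm M (\<lambda>x. g x - f x) \<le> \<epsilon>"
    using \<open>\<epsilon> \<ge> 0\<close> by (auto intro: power2_le_imp_le)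
qed

lemma l2_complete:
  assumes F: "\<And>n. F n \<in> L2 M"
    and Cauchy: "\<And>\<epsilon>. \<epsilon> > 0 \<Longrightarrow> \<exists>N. \<forall>m\<ge>N. \<forall>n\<ge>N. l2norm M (\<lambda>x. F m x - F n x) < \<epsilon>"
  obtains f where "f \<in> L2 M" "(\<lambda>n. l2norm M (\<lambda>x. F n x - f x)) \<longlonglongrightarrow> 0"
proof -
  have "\<exists>N. \<forall>m\<ge>N. \<forall>n\<ge>N. l2norm M (\<lambda>x. F m x - F n x) < (1/2) ^ k" for k :: nat
    by (rule Cauchy) simp
  then obtain N where N: "\<And>k m n. m \<ge> N k \<Longrightarrow> n \<ge> N k \<Longrightarrow> l2norm M (\<lambda>x. F m x - F n x) < (1/2) ^ k"
    by metis
  \<comment> \<open>Summing the thresholds makes \<open>r\<close> monotone and at least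
    \<open>N k\<close>; the extra \<open>k\<close> sends it to infinity, so the subsequence
    eventually passes every Cauchy threshold.\<close>
  define r where "r k = k + (\<Sum>j\<le>k. N j)" for k
  have r: "r k \<ge> N k" "r k \<ge> k" "r (Suc k) \<ge> r k" for k
    using member_le_sum[of k "{..k}" N] by (auto simp: r_def)
  note [measurable] = F[THEN L2_measurable]
  define f where "f x = lim (\<lambda>k. F (r k) x)" for x
  have f [measurable]: "f \<in> borel_measurable M" unfolding f_def by measurable
  have "AE x in M. convergent (\<lambda>k. F (r k) x)"
    by (rule l2_fast_Cauchy_limit[OF F], rule less_imp_le, rule N)
       (use r order_trans in blast)+
  then have lim: "AE x in M. (\<lambda>k. F (r k) x) \<longlonglongrightarrow> f x"
    by eventually_elim (simp add: f_def convergent_LIMSEQ_iff)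
  have ev: "\<forall>\<^sub>F k in sequentially. l2norm M (\<lambda>x. F n x - F (r k) x) \<le> \<epsilon>"
    if "\<forall>m\<ge>K. \<forall>n\<ge>K. l2norm M (\<lambda>x. F m x - F n x) < \<epsilon>" "n \<ge> K" for n K \<epsilon>
    unfolding eventually_sequentially
  proof (intro exI[of _ K] allI impI less_imp_le)
    fix k assume "K \<le> k"
    then show "l2norm M (\<lambda>x. F n x - F (r k) x) < \<epsilon>" using that r(2)[of k] by simp
  qed
  have "\<forall>m\<ge>N 0. \<forall>n\<ge>N 0. l2norm M (\<lambda>x. F m x - F n x) < 1"
    using N[of 0] by simp
  then have 1: "f \<in> L2 M"
    using l2_AE_limit(1)[OF F F f lim ev[OF _ order_refl]] by blast
  have "(\<lambda>n. l2norm M (\<lambda>x. F n x - f x)) \<longlonglongrightarrow> 0"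
  proof (rule LIMSEQ_I)
    fix \<epsilon> :: real assume "\<epsilon> > 0"
    then obtain K where K: "\<forall>m\<ge>K. \<forall>n\<ge>K. l2norm M (\<lambda>x. F m x - F n x) < \<epsilon> / 2"
      using Cauchy[of "\<epsilon> / 2"] by auto
    have "l2norm M (\<lambda>x. F n x - f x) \<le> \<epsilon> / 2" if "n \<ge> K" for n
      by (rule l2_AE_limit(2)[OF F F f lim ev[OF K that]])
    then show "\<exists>K. \<forall>n\<ge>K. norm (l2norm M (\<lambda>x. F n x - f x) - 0) < \<epsilon>"
      using \<open>\<epsilon> > 0\<close> by (intro exI[of _ K]) (force simp: l2norm_nonneg)
  qed
  with 1 show ?thesis by (rule that)
qed

text \<open>The representing vector is the minimizer of a quadratic functional: if \<open>h\<close>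
  represents \<open>\<phi>\<close>, then \<open>J f\<close> is the squared distance of
  \<open>f\<close> and \<open>h\<close> minus the squared norm of \<open>h\<close>. Completeness
  gives the minimizer, and the vanishing first variation gives the representation.\<close>

lemma l2_Riesz:
  assumes lin: "\<And>f g a b. f \<in> L2 M \<Longrightarrow> g \<in> L2 M \<Longrightarrow> \<phi> (\<lambda>x. a * f x + b * g x) = a * \<phi> f + b * \<phi> g"
    and bound: "\<And>f. f \<in> L2 M \<Longrightarrow> cmod (\<phi> f) \<le> C * l2norm M f"
  obtains h where "h \<in> L2 M" "\<And>f. f \<in> L2 M \<Longrightarrow> \<phi> f = l2inner M f h"
proof -
  define J where "J f = (l2norm M f)\<^sup>2 - 2 * Re (\<phi> f)" for f
  have J_ge: "J f \<ge> - C\<^sup>2" if "f \<in> L2 M" for f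
  proof -
    have "0 \<le> (l2norm M f - C)\<^sup>2" by simp
    then show ?thesis
      using bound[OF that] complex_Re_le_cmod[of "\<phi> f"]
      unfolding J_def power2_diff by (simp add: algebra_simps)
  qed
  define m where "m = (INF f\<in>L2 M. J f)"
  have bdd: "bdd_below (J ` L2 M)" using J_ge by (auto intro!: bdd_belowI[of _ "- C\<^sup>2"])
  have m_le: "m \<le> J f" if "f \<in> L2 M" for f
    unfolding m_def by (rule cINF_lower[OF bdd that])
  have "\<exists>f\<in>L2 M. J f < m + \<delta>" if "\<delta> > 0" for \<delta>
    using cInf_lessD[of "J ` L2 M" "m + \<delta>"] that L2_zero by (auto simp: m_def)
  then have "\<exists>f\<in>L2 M. J f < m + 1 / real (Suc n)" for n by simp
  then obtain F where F: "\<And>n. F n \<in> L2 M" "\<And>n. J (F n) < m + 1 / real (Suc n)"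
    by metis
  \<comment> \<open>parallelogram identity for the functional \<open>J\<close>\<close>
  have par: "(l2norm M (\<lambda>x. f x - g x))\<^sup>2 = 2 * J f + 2 * J g - 4 * J (\<lambda>x. (1/2) * f x + (1/2) * g x)"
    if "f \<in> L2 M" "g \<in> L2 M" for f g
    using l2norm_lincomb_sq[OF that, of 1 "-1"] l2norm_lincomb_sq[OF that, of "1/2" "1/2"] arg_cong[OF lin[OF that, of "1/2" "1/2"], of Re]
    by (simp add: J_def power2_eq_square field_simps)
  \<comment> \<open>The midpoint of two near-minimizers still has \<open>J\<close> at least
    \<open>m\<close>, so only the two excesses over \<open>m\<close> survive, each doubled.\<close>
  have par_le: "(l2norm M (\<lambda>x. F p x - F n x))\<^sup>2 < 2 / real (Suc p) + 2 / real (Suc n)" for p n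
    using par[OF F(1) F(1), of p n] F(2)[of p] F(2)[of n]
      m_le[OF L2_lincomb[OF F(1) F(1)], of "1/2" p "1/2" n] by simp
  obtain h where h: "h \<in> L2 M" and lim: "(\<lambda>n. l2norm M (\<lambda>x. F n x - h x)) \<longlonglongrightarrow> 0"
  proof (rule l2_complete)
    fix \<epsilon> :: real assume "\<epsilon> > 0"
    then obtain N where N: "4 / \<epsilon>\<^sup>2 < real (Suc N)"
      using reals_Archimedean2 by (meson less_trans of_nat_less_iff lessI)
    have "l2norm M (\<lambda>x. F p x - F n x) < \<epsilon>" if "p \<ge> N" "n \<ge> N" for p n
    proof (rule power2_less_imp_less)
      have "2 / real (Suc p) \<le> 2 / real (Suc N)" "2 / real (Suc n) \<le> 2 / real (Suc N)"
        using that by (auto intro!: divide_left_mono)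
      moreover have "4 / real (Suc N) < \<epsilon>\<^sup>2" using N \<open>\<epsilon> > 0\<close> by (simp add: field_simps)
      ultimately show "(l2norm M (\<lambda>x. F p x - F n x))\<^sup>2 < \<epsilon>\<^sup>2" using par_le[of p n] by linarith
    qed (use \<open>\<epsilon> > 0\<close> in simp)
    then show "\<exists>N. \<forall>p\<ge>N. \<forall>n\<ge>N. l2norm M (\<lambda>x. F p x - F n x) < \<epsilon>" by blast
  qed (use F in auto)
  have "(\<lambda>n. \<phi> (F n) - \<phi> h) \<longlonglongrightarrow> 0"
  proof (rule Lim_null_comparison)
    show "(\<lambda>n. C * l2norm M (\<lambda>x. F n x - h x)) \<longlonglongrightarrow> 0"
      using tendsto_mult_left[OF lim, of C] by simp
    show "\<forall>\<^sub>F n in sequentially. cmod (\<phi> (F n) - \<phi> h) \<le> C * l2norm M (\<lambda>x. F n x - h x)"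
      using bound[OF L2_diff[OF F(1) h]] lin[OF F(1) h, of 1 _ "-1"] by (simp add: always_eventually)
  qed
  then have "(\<lambda>n. \<phi> (F n)) \<longlonglongrightarrow> \<phi> h" by (simp add: LIM_zero_iff)
  then have "(\<lambda>n. J (F n)) \<longlonglongrightarrow> J h"
    unfolding J_def by (intro tendsto_intros l2norm_tendsto always_eventually allI F h lim)
  moreover have "(\<lambda>n. m + 1 / real (Suc n)) \<longlonglongrightarrow> m + 0"
    by (intro tendsto_add tendsto_const LIMSEQ_Suc lim_1_over_n)
  ultimately have Jh: "J h \<le> m"
    using F(2) by (intro LIMSEQ_le[of "\<lambda>n. J (F n)" _ "\<lambda>n. m + 1 / real (Suc n)"]) (auto intro: less_imp_le)
  have Re_eq: "Re (l2inner M f h) = Re (\<phi> f)" if f: "f \<in> L2 M" for f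
  proof -
    define d where "d = Re (l2inner M f h) - Re (\<phi> f)"
    \<comment> \<open>This is \<open>J\<close> at \<open>h\<close> perturbed by t *
      \<open>f\<close>, minus the minimum \<open>J h\<close>.\<close>
    have *: "0 \<le> 2 * t * d + t\<^sup>2 * (l2norm M f)\<^sup>2" for t
      using m_le[OF L2_lincomb[OF f h], of "complex_of_real t" 1] Jh lin[OF f h, of "complex_of_real t" 1]
        l2norm_lincomb_sq[OF f h, of "complex_of_real t" 1]
      by (simp add: J_def d_def algebra_simps)
    \<comment> \<open>The minimum over \<open>t\<close> would be at -d divided by the squared norm
      of \<open>f\<close>; the added 1 keeps the denominator positive and still leaves a strictly
      negative value unless \<open>d\<close> is 0.\<close>
    define n where "n = (l2norm M f)\<^sup>2 + 1"
    have n: "n > 0" by (simp add: n_def add_nonneg_pos)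
    have "0 \<le> 2 * (- d / n) * d + (- d / n)\<^sup>2 * (n - 1)" using *[of "- d / n"] by (simp add: n_def)
    also have "\<dots> = - (d\<^sup>2 * (n + 1) / n\<^sup>2)"
      using n by (simp add: power2_eq_square field_simps)
    finally have "d\<^sup>2 * (n + 1) / n\<^sup>2 \<le> 0" by simp
    then have "d\<^sup>2 * (n + 1) \<le> 0" using n by (simp add: divide_le_0_iff)
    then have "d = 0" using n by (simp add: mult_le_0_iff)
    then show ?thesis by (simp add: d_def)
  qed
  have "\<phi> f = l2inner M f h" if f: "f \<in> L2 M" for f
  proof (rule complex_eqI)
    show "Re (\<phi> f) = Re (l2inner M f h)" using Re_eq[OF f] by simp
    show "Im (\<phi> f) = Im (l2inner M f h)"
      \<comment> \<open>The real part at \<i> * \<open>f\<close> is minus the imaginary part at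
        \<open>f\<close>.\<close>
      using Re_eq[OF L2_scale[OF f, of "\<i>"]] lin[OF f f, of "\<i>" 0] by (simp add: l2inner_scale_left)
  qed
  with h show ?thesis by (rule that)
qed

section \<open>Step functions and the reproducing kernel Hilbert space of a measure\<close>

text \<open>The Krein-Feller derivative of a kernel combination: integrating \<open>kstep c\<close>
  over \<open>A\<close> gives the sum of \<open>c t\<close> times the measure of \<open>A\<close>
  \<inter> \<open>t\<close>. One coefficient family thus describes both objects.\<close>

definition kstep :: "('a set \<Rightarrow> complex) \<Rightarrow> 'a \<Rightarrow> complex" where
  "kstep c x = (\<Sum>t | c t \<noteq> 0. c t * indicator t x)"

lemma kstep_eq_sum:
  assumes "finite T" "{t. c t \<noteq> 0} \<subseteq> T"
  shows "kstep c x = (\<Sum>t\<in>T. c t * indicator t x)"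
  unfolding kstep_def using assms by (intro sum.mono_neutral_left) auto

lemma kstep_diff:
  assumes "c \<in> kcoeff T" "d \<in> kcoeff T"
  shows "kstep (\<lambda>t. c t - d t) x = kstep c x - kstep d x"
proof -
  \<comment> \<open>Cancellation can shrink the support of the difference, so all three sums are
    taken over one larger set.\<close>
  let ?U = "{t. c t \<noteq> 0} \<union> {t. d t \<noteq> 0}"
  have fin: "finite ?U" using assms by (simp add: kcoeff_def)
  show ?thesis
    by (subst (1 2 3) kstep_eq_sum[OF fin]) (auto simp: sum_subtractf left_diff_distrib)
qed

lemma kstep_L2: "c \<in> kcoeff (Ffin M) \<Longrightarrow> kstep c \<in> L2 M"
  unfolding kstep_def[abs_def] by (rule L2_sum) (auto simp: kcoeff_def intro: L2_indicator)

text \<open>The sets are the level sets of the nonzero values. Each has finite measure by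
  Chebyshev's argument: the squared modulus of \<open>s\<close>, divided by that of the value,
  dominates the indicator.\<close>

lemma simple_function_eq_kstep:
  assumes s: "simple_function M s" "s \<in> L2 M"
  obtains c where "c \<in> kcoeff (Ffin M)" "\<And>x. x \<in> space M \<Longrightarrow> kstep c x = s x"
proof -
  define Y where "Y = s ` space M - {0}"
  define P where "P y = s -` {y} \<inter> space M" for y
  have Y: "finite Y" using s(1) by (simp add: Y_def simple_function_def)
  have P_Ffin: "P y \<in> Ffin M" if "y \<in> Y" for y
  proof -
    have y: "y \<noteq> 0" "y \<in> s ` space M" using that by (auto simp: Y_def)
    have P: "P y \<in> sets M" using s(1) y(2) unfolding simple_function_def P_def by blast
    have "integrable M (indicator (P y) :: 'a \<Rightarrow> real)"
    proof (rule Bochner_Integration.integrable_bound)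
      show "integrable M (\<lambda>x. (cmod (s x))\<^sup>2 / (cmod y)\<^sup>2)"
        using L2_integrable_sq[OF s(2)] by simp
      show "AE x in M. norm (indicator (P y) x :: real) \<le> norm ((cmod (s x))\<^sup>2 / (cmod y)\<^sup>2)"
        using y by (auto simp: P_def indicator_def)
    qed (use P in simp)
    then show ?thesis using P sets.sets_into_space[OF P]
      by (simp add: integrable_indicator_iff Ffin_def Int_absorb2)
  qed
  have inj: "inj_on P Y" by (auto simp: inj_on_def P_def Y_def)
  \<comment> \<open>Coefficients are indexed by sets, so a value is recovered from its level set;
    \<open>P\<close> is injective because every value in \<open>Y\<close> is attained.\<close>
  define c where "c t = (if t \<in> P ` Y then inv_into Y P t else 0)" for t
  have c: "c (P y) = y" if "y \<in> Y" for y using that inj by (simp add: c_def)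
  have supp: "{t. c t \<noteq> 0} = P ` Y"
    using c by (auto simp: c_def Y_def)
  show ?thesis
  proof
    show "c \<in> kcoeff (Ffin M)" using Y P_Ffin by (auto simp: kcoeff_def supp)
    fix x assume x: "x \<in> space M"
    have "kstep c x = (\<Sum>y\<in>Y. y * indicator (P y) x)"
      unfolding kstep_def supp by (simp add: sum.reindex[OF inj] c)
    also have "\<dots> = (\<Sum>y\<in>Y. if s x = y then y else 0)"
      using x by (intro sum.cong) (auto simp: P_def indicator_def)
    also have "\<dots> = s x" using Y x by (auto simp: Y_def)
    finally show "kstep c x = s x" .
  qed
qed

lemma l2_kstep_dense:
  assumes f: "f \<in> L2 M"
  obtains c where "\<And>n. c n \<in> kcoeff (Ffin M)" "(\<lambda>n. l2norm M (\<lambda>x. kstep (c n) x - f x)) \<longlonglongrightarrow> 0"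
proof -
  note [measurable] = L2_measurable[OF f]
  obtain s where s: "\<And>i. simple_function M (s i)"
    "\<And>x. x \<in> space M \<Longrightarrow> (\<lambda>i. s i x) \<longlonglongrightarrow> f x"
    "\<And>i x. x \<in> space M \<Longrightarrow> cmod (s i x) \<le> 2 * cmod (f x)"
    using borel_measurable_implies_sequence_metric[OF L2_measurable[OF f], of 0] by (auto simp: dist_norm) metis
  note [measurable] = s(1)[THEN borel_measurable_simple_function]
  have sL2: "s i \<in> L2 M" for i
  proof -
    have "integrable M (\<lambda>x. (cmod (s i x))\<^sup>2)"
    proof (rule Bochner_Integration.integrable_bound)
      show "integrable M (\<lambda>x. (2 * cmod (f x))\<^sup>2)"
        using L2_integrable_sq[OF f] by (simp add: power_mult_distrib)
      show "AE x in M. norm ((cmod (s i x))\<^sup>2) \<le> norm ((2 * cmod (f x))\<^sup>2)"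
        unfolding real_norm_def abs_power2 by (intro AE_I2 power_mono s(3)) auto
    qed measurable
    then show ?thesis by (simp add: L2_def)
  qed
  have "\<exists>c. c \<in> kcoeff (Ffin M) \<and> (\<forall>x\<in>space M. kstep c x = s i x)" for i
    using simple_function_eq_kstep[OF s(1) sL2] by metis
  then obtain c where c: "\<And>i. c i \<in> kcoeff (Ffin M)" "\<And>i x. x \<in> space M \<Longrightarrow> kstep (c i) x = s i x"
    by metis
  have eq: "l2norm M (\<lambda>x. kstep (c n) x - f x) = sqrt (LINT x|M. (cmod (s n x - f x))\<^sup>2)" for n
    unfolding l2norm_def by (intro arg_cong[of _ _ sqrt] Bochner_Integration.integral_cong) (auto simp: c)
  have "(\<lambda>n. LINT x|M. (cmod (s n x - f x))\<^sup>2) \<longlonglongrightarrow> (LINT x|M. 0)"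
  proof (rule integral_dominated_convergence)
    \<comment> \<open>The approximating simple functions are bounded by twice the modulus of
      \<open>f\<close>, their distance from \<open>f\<close> by three times.\<close>
    show "integrable M (\<lambda>x. (3 * cmod (f x))\<^sup>2)"
      using L2_integrable_sq[OF f] by (simp add: power_mult_distrib)
    show "AE x in M. (\<lambda>n. (cmod (s n x - f x))\<^sup>2) \<longlonglongrightarrow> 0"
    proof (rule AE_I2)
      fix x assume "x \<in> space M"
      then have "(\<lambda>n. (cmod (s n x - f x))\<^sup>2) \<longlonglongrightarrow> (cmod (f x - f x))\<^sup>2"
        by (intro tendsto_intros s)
      then show "(\<lambda>n. (cmod (s n x - f x))\<^sup>2) \<longlonglongrightarrow> 0" by simp
    qed
    fix n
    have "cmod (s n x - f x) \<le> 3 * cmod (f x)" if "x \<in> space M" for x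
      using norm_triangle_ineq4[of "s n x" "f x"] s(3)[OF that, of n] by linarith
    then show "AE x in M. norm ((cmod (s n x - f x))\<^sup>2) \<le> (3 * cmod (f x))\<^sup>2"
      unfolding real_norm_def abs_power2 by (intro AE_I2 power_mono) auto
  qed measurable
  then have "(\<lambda>n. l2norm M (\<lambda>x. kstep (c n) x - f x)) \<longlonglongrightarrow> 0"
    unfolding eq using tendsto_real_sqrt by fastforce
  with c(1) show ?thesis by (rule that)
qed

lemma l2inner_indicator_eq: "l2inner M h (indicator A) = (LINT x|M. indicator A x * h x)"
proof -
  have "cnj (indicator A x) = (indicator A x :: complex)" for x by (simp add: indicator_def)
  then show ?thesis by (simp add: l2inner_def mult.commute)
qed

text \<open>The difference is orthogonal to all step functions on sets of finite measure. These
  approximate the difference itself, which is therefore orthogonal to itself.\<close>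

lemma l2_eq_of_indicator:
  assumes h: "h \<in> L2 M" and k: "k \<in> L2 M"
    and eq: "\<And>A. A \<in> Ffin M \<Longrightarrow> (LINT x|M. indicator A x * h x) = (LINT x|M. indicator A x * k x)"
  shows "AE x in M. h x = k x"
proof -
  define g where "g x = h x - k x" for x
  have g: "g \<in> L2 M" unfolding g_def using h k by (rule L2_diff)
  obtain c where c: "\<And>n. c n \<in> kcoeff (Ffin M)" and lim: "(\<lambda>n. l2norm M (\<lambda>x. kstep (c n) x - g x)) \<longlonglongrightarrow> 0"
    by (rule l2_kstep_dense[OF g]) blast
  have "l2inner M (kstep (c n)) g = 0" for n
  proof -
    have "l2inner M (indicator t) g = 0" if "t \<in> Ffin M" for t
      using eq[OF that] l2inner_commute[of M "indicator t" g] h k L2_indicator[OF that]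
      by (simp add: l2inner_indicator_eq[symmetric] g_def[abs_def] l2inner_diff_left)
    then show ?thesis using c[of n] g unfolding kstep_def[abs_def]
      by (subst l2inner_sum_left) (auto simp: kcoeff_def intro!: L2_indicator sum.neutral)
  qed
  then have "(\<lambda>n. 0) \<longlonglongrightarrow> l2inner M g g"
    using l2inner_tendsto[OF kstep_L2[OF c] g g lim] by simp
  then have "l2norm M g = 0"
    by (simp add: LIMSEQ_const_iff l2inner_self)
  then show ?thesis using g by (simp add: l2norm_eq_0_iff g_def)
qed

text \<open>The kernel matrix is the Gram matrix of the indicators, so passing from kernel
  combinations to step functions is isometric.\<close>

lemma knorm_measure:
  assumes "c \<in> kcoeff (Ffin M)"
  shows "knorm (\<lambda>A B. complex_of_real (measure M (A \<inter> B))) c = l2norm M (kstep c)"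
proof -
  have ind: "indicator t \<in> L2 M" "t \<in> sets M" if "c t \<noteq> 0" for t
    using assms that by (auto simp: kcoeff_def Ffin_def intro!: L2_indicator)
  have "l2inner M (kstep c) (kstep c)
      = (\<Sum>t | c t \<noteq> 0. c t * l2inner M (indicator t) (kstep c))"
    by (subst kstep_def[abs_def]) (auto simp: assms ind kstep_L2 intro!: l2inner_sum_left)
  also have "\<dots> = (\<Sum>t | c t \<noteq> 0. \<Sum>s | c s \<noteq> 0. cnj (c s) * c t * l2inner M (indicator t) (indicator s))"
  proof (intro sum.cong refl)
    fix t assume "t \<in> {t. c t \<noteq> 0}"
    then have t: "c t \<noteq> 0" by simp
    have "l2inner M (indicator t) (kstep c) = cnj (\<Sum>s | c s \<noteq> 0. c s * l2inner M (indicator s) (indicator t))"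
      by (subst l2inner_commute, subst kstep_def[abs_def], subst l2inner_sum_left) (auto simp: ind t)
    also have "\<dots> = (\<Sum>s | c s \<noteq> 0. cnj (c s) * l2inner M (indicator t) (indicator s))"
      by (simp add: l2inner_commute[of M "indicator t"])
    finally show "c t * l2inner M (indicator t) (kstep c)
        = (\<Sum>s | c s \<noteq> 0. cnj (c s) * c t * l2inner M (indicator t) (indicator s))"
      by (simp add: sum_distrib_left mult_ac)
  qed
  also have "\<dots> = (\<Sum>s | c s \<noteq> 0. \<Sum>t | c t \<noteq> 0. cnj (c s) * c t * complex_of_real (measure M (s \<inter> t)))"
  proof (subst sum.swap, intro sum.cong refl)
    fix s t assume "s \<in> {s. c s \<noteq> 0}" "t \<in> {t. c t \<noteq> 0}"
    then have "s \<inter> t \<in> sets M" using ind by auto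
    moreover have "(\<lambda>x. indicator s x * indicator t x :: complex) = (\<lambda>x. complex_of_real (indicator (s \<inter> t) x))"
      by (auto simp: indicator_def)
    ultimately show "cnj (c s) * c t * l2inner M (indicator t) (indicator s)
        = cnj (c s) * c t * complex_of_real (measure M (s \<inter> t))"
      unfolding l2inner_indicator_eq by (simp add: measure_def Int_absorb2 sets.sets_into_space)
  qed
  finally show ?thesis
    unfolding l2inner_self knorm_def by (metis Re_complex_of_real l2norm_nonneg real_sqrt_unique)
qed

text \<open>Step functions converging to \<open>h\<close> give kernel combinations that are Cauchy
  by the isometry. Evaluating a combination at \<open>A\<close> is pairing its step function with
  the indicator of \<open>A\<close>, so mean square convergence yields pointwise convergence to
  \<open>M\<close>.\<close>

lemma rkhs_measure_integral:
  assumes h: "h \<in> L2 \<mu>" and M: "\<And>A. A \<in> Ffin \<mu> \<Longrightarrow> M A = (LINT x|\<mu>. indicator A x * h x)"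
  shows "M \<in> rkhs_measure \<mu>"
proof -
  let ?K = "\<lambda>A B. complex_of_real (measure \<mu> (A \<inter> B))"
  obtain c where c: "\<And>n. c n \<in> kcoeff (Ffin \<mu>)" and lim: "(\<lambda>n. l2norm \<mu> (\<lambda>x. kstep (c n) x - h x)) \<longlonglongrightarrow> 0"
    by (rule l2_kstep_dense[OF h]) blast
  have "\<exists>N. \<forall>m\<ge>N. \<forall>n\<ge>N. knorm ?K (\<lambda>t. c m t - c n t) < \<epsilon>" if e: "\<epsilon> > 0" for \<epsilon>
  proof -
    obtain N where N: "\<And>n. n \<ge> N \<Longrightarrow> l2norm \<mu> (\<lambda>x. kstep (c n) x - h x) < \<epsilon> / 2"
      using LIMSEQ_D[OF lim half_gt_zero[OF e]] by (auto simp: l2norm_nonneg simp del: less_divide_eq_numeral1)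
    have "knorm ?K (\<lambda>t. c m t - c n t) < \<epsilon>" if "m \<ge> N" "n \<ge> N" for m n
    proof -
      have "{t. c m t - c n t \<noteq> 0} \<subseteq> {t. c m t \<noteq> 0} \<union> {t. c n t \<noteq> 0}" by auto
      then have "(\<lambda>t. c m t - c n t) \<in> kcoeff (Ffin \<mu>)"
        using c[of m] c[of n] unfolding kcoeff_def
        by (auto intro: finite_subset[of _ "{t. c m t \<noteq> 0} \<union> {t. c n t \<noteq> 0}"])
      then have "knorm ?K (\<lambda>t. c m t - c n t) = l2norm \<mu> (\<lambda>x. kstep (c m) x - kstep (c n) x)"
        by (simp add: knorm_measure kstep_diff[OF c c, abs_def])
      also have "\<dots> \<le> l2norm \<mu> (\<lambda>x. kstep (c m) x - h x) + l2norm \<mu> (\<lambda>x. kstep (c n) x - h x)"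
        using l2norm_triangle_diff[OF kstep_L2[OF c] h kstep_L2[OF c], of m n]
          l2norm_minus_commute[of \<mu> h "kstep (c n)"] by simp
      also have "\<dots> < \<epsilon>" using N[OF that(1)] N[OF that(2)] by simp
      finally show ?thesis .
    qed
    then show ?thesis by blast
  qed
  moreover have "(\<lambda>n. kcomb ?K (c n) A) \<longlonglongrightarrow> M A" if A: "A \<in> Ffin \<mu>" for A
  proof -
    have "kcomb ?K (c n) A = l2inner \<mu> (kstep (c n)) (indicator A)" for n
    proof -
      have "?K A t = l2inner \<mu> (indicator t) (indicator A)" if "t \<in> Ffin \<mu>" for t
      proof -
        have "A \<inter> t \<in> sets \<mu>" using A that by (auto simp: Ffin_def)
        moreover have "(\<lambda>x. indicator A x * indicator t x :: complex) = (\<lambda>x. complex_of_real (indicator (A \<inter> t) x))"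
          by (auto simp: indicator_def)
        ultimately show ?thesis
          unfolding l2inner_indicator_eq by (simp add: measure_def Int_absorb2 sets.sets_into_space)
      qed
      then show ?thesis
        unfolding kcomb_def kstep_def[abs_def] using c[of n] L2_indicator[OF A]
        by (subst l2inner_sum_left) (auto simp: kcoeff_def intro!: L2_indicator sum.cong)
    qed
    then show ?thesis
      using l2inner_tendsto[OF kstep_L2[OF c] h L2_indicator[OF A] lim] M[OF A]
      by (simp add: l2inner_indicator_eq)
  qed
  ultimately show ?thesis using c unfolding rkhs_measure_def rkhs_def by blast
qed

section \<open>Adjoints\<close>

text \<open>Pairing with \<open>w\<close> removes the null sets on which \<open>V\<close> may fail
  to be linear, so the functional is exactly linear. The Riesz theorem also asks for a norm bound,
  which has to be extracted from sequential continuity.\<close>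

lemma l2_adjoint_exists:
  assumes V: "l2_continuous_linear M N V" and w: "w \<in> L2 N"
  shows "\<exists>h. h \<in> L2 M \<and> (\<forall>f\<in>L2 M. l2inner N (V f) w = l2inner M f h)"
proof -
  have VL2: "V f \<in> L2 N" if "f \<in> L2 M" for f
    using V that by (simp add: l2_continuous_linear_def)
  have Vlin: "AE y in N. V (\<lambda>x. a * f x + b * g x) y = a * V f y + b * V g y"
    if "f \<in> L2 M" "g \<in> L2 M" for a b f g
    using V that by (simp add: l2_continuous_linear_def)
  have Vcont: "(\<lambda>n. l2norm N (\<lambda>y. V (F n) y - V f y)) \<longlonglongrightarrow> 0"
    if "\<And>n::nat. F n \<in> L2 M" "f \<in> L2 M" "(\<lambda>n. l2norm M (\<lambda>x. F n x - f x)) \<longlonglongrightarrow> 0" for F f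
    using V that by (simp add: l2_continuous_linear_def)
  define \<phi> where "\<phi> f = l2inner N (V f) w" for f
  have lin: "\<phi> (\<lambda>x. a * f x + b * g x) = a * \<phi> f + b * \<phi> g" if "f \<in> L2 M" "g \<in> L2 M" for f g a b
  proof -
    have "\<phi> (\<lambda>x. a * f x + b * g x) = l2inner N (\<lambda>y. a * V f y + b * V g y) w"
      unfolding \<phi>_def using that w Vlin[OF that]
      by (intro l2inner_cong_AE L2_measurable VL2 L2_lincomb) auto
    then show ?thesis using that w by (simp add: l2inner_lincomb_left VL2 \<phi>_def)
  qed
  have "\<exists>C. \<forall>f\<in>L2 M. cmod (\<phi> f) \<le> C * l2norm M f"
  proof (rule ccontr)
    assume "\<nexists>C. \<forall>f\<in>L2 M. cmod (\<phi> f) \<le> C * l2norm M f"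
    then have "\<exists>f\<in>L2 M. cmod (\<phi> f) > real (Suc n) * l2norm M f" for n
      by (meson not_le)
    then obtain F where F: "\<And>n. F n \<in> L2 M" "\<And>n. cmod (\<phi> (F n)) > real (Suc n) * l2norm M (F n)"
      by metis
    have pos: "cmod (\<phi> (F n)) > 0" for n
      using le_less_trans[OF _ F(2)[of n], of 0] by (simp add: l2norm_nonneg)
    \<comment> \<open>Rescaling the counterexamples gives vectors tending to 0 on which the
      functional is constantly 1, against continuity at 0.\<close>
    define G where "G n x = (1 / \<phi> (F n)) * F n x" for n x
    have G: "G n \<in> L2 M" for n unfolding G_def by (rule L2_scale[OF F(1)])
    have "\<phi> (G n) = 1" for n
      using lin[OF F(1) F(1), of "1 / \<phi> (F n)" n 0 n] pos[of n] by (simp add: G_def[abs_def])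
    moreover have "(\<lambda>n. l2norm M (\<lambda>x. G n x - 0)) \<longlonglongrightarrow> 0"
    proof (rule Lim_null_comparison)
      show "(\<lambda>n. 1 / real (Suc n)) \<longlonglongrightarrow> 0" by (rule LIMSEQ_Suc[OF lim_1_over_n])
      have "l2norm M (G n) \<le> 1 / real (Suc n)" for n
        using F(2)[of n] pos[of n]
        by (simp add: G_def[abs_def] l2norm_scale[of M "1 / \<phi> (F n)", simplified] norm_divide field_simps)
      then show "\<forall>\<^sub>F n in sequentially. norm (l2norm M (\<lambda>x. G n x - 0)) \<le> 1 / real (Suc n)"
        by (simp add: l2norm_nonneg)
    qed
    ultimately have "(\<lambda>n. 1) \<longlonglongrightarrow> \<phi> (\<lambda>_. 0)"
      using l2inner_tendsto[OF VL2[OF G] VL2[OF L2_zero] w Vcont[OF G L2_zero]]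
      by (simp add: \<phi>_def)
    moreover have "\<phi> (\<lambda>_. 0) = 0" using lin[OF L2_zero L2_zero, of 0 0] by simp
    ultimately show False by (simp add: LIMSEQ_const_iff)
  qed
  then obtain C where C: "\<And>f. f \<in> L2 M \<Longrightarrow> cmod (\<phi> f) \<le> C * l2norm M f" by blast
  obtain h where "h \<in> L2 M" "\<And>f. f \<in> L2 M \<Longrightarrow> \<phi> f = l2inner M f h"
    by (rule l2_Riesz[of M \<phi> C]) (use lin C in auto)
  then show ?thesis unfolding \<phi>_def by blast
qed

lemma l2adjoint_eq_krein_feller:
  assumes V: "l2_continuous_linear \<mu> N V" and w: "w \<in> L2 N"
    and M: "\<And>D. D \<in> Ffin \<mu> \<Longrightarrow> M D = l2inner N (V (indicator D)) w"
    and real: "\<And>D. D \<in> Ffin \<mu> \<Longrightarrow> cnj (M D) = M D"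
  shows "M \<in> rkhs_measure \<mu>" "AE x in \<mu>. l2adjoint \<mu> N V w x = krein_feller \<mu> M x"
proof -
  define h where "h = l2adjoint \<mu> N V w"
  have h: "h \<in> L2 \<mu>" "\<And>f. f \<in> L2 \<mu> \<Longrightarrow> l2inner N (V f) w = l2inner \<mu> f h"
    using someI_ex[OF l2_adjoint_exists[OF V w]] unfolding h_def l2adjoint_def by auto
  have Mh: "M D = (LINT x|\<mu>. indicator D x * h x)" if "D \<in> Ffin \<mu>" for D
    using M[OF that] real[OF that] h(2)[OF L2_indicator[OF that]] l2inner_commute[of \<mu> h "indicator D"]
    by (simp add: l2inner_indicator_eq)
  show "M \<in> rkhs_measure \<mu>" by (rule rkhs_measure_integral[OF h(1) Mh])
  \<comment> \<open>The adjoint value itself witnesses that the choice in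
    \<open>krein_feller\<close> succeeds; the chosen function then has the same integrals as
    \<open>h\<close>.\<close>
  have "\<exists>k. k \<in> L2 \<mu> \<and> (\<forall>A\<in>Ffin \<mu>. M A = (LINT x|\<mu>. indicator A x * k x))"
    using h(1) Mh by blast
  from someI_ex[OF this, folded krein_feller_def]
  have "krein_feller \<mu> M \<in> L2 \<mu> \<and> (\<forall>A\<in>Ffin \<mu>. M A = (LINT x|\<mu>. indicator A x * krein_feller \<mu> M x))" .
  then show "AE x in \<mu>. l2adjoint \<mu> N V w x = krein_feller \<mu> M x"
    unfolding h_def[symmetric] using h(1) Mh by (intro l2_eq_of_indicator) auto
qed

section \<open>The universal Hilbert space\<close>

lemma absolutely_continuous_trans:
  "absolutely_continuous \<tau> \<nu> \<Longrightarrow> absolutely_continuous \<nu> \<mu> \<Longrightarrow> absolutely_continuous \<tau> \<mu>"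
  by (auto simp: absolutely_continuous_def)

lemma absolutely_continuous_refl: "absolutely_continuous \<mu> \<mu>"
  by (simp add: absolutely_continuous_def)

text \<open>A density that is integrable and strictly positive makes the measure finite without
  creating new null sets.\<close>

lemma ex_equivalent_finite_measure:
  assumes "sigma_finite_measure \<mu>"
  obtains \<mu>' where "sets \<mu>' = sets \<mu>" "finite_measure \<mu>'" "absolutely_continuous \<mu>' \<mu>"
proof -
  interpret sigma_finite_measure \<mu> by fact
  obtain h where h: "h \<in> borel_measurable \<mu>" "integral\<^sup>N \<mu> h \<noteq> \<infinity>" "\<And>x. x \<in> space \<mu> \<Longrightarrow> 0 < h x"
    using Ex_finite_integrable_function by auto
  show ?thesis
  proof
    show "finite_measure (density \<mu> h)"
      by (rule finite_measureI) (use h in \<open>auto simp: emeasure_density cong: nn_integral_cong\<close>)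
    have "A \<in> null_sets \<mu>" if "AE x in \<mu>. x \<in> A \<longrightarrow> h x = 0" "A \<in> sets \<mu>" for A
    proof -
      have "AE x in \<mu>. x \<notin> A"
        using that(1) AE_space by eventually_elim (use h(3) in force)
      then show ?thesis using that(2) by (simp add: AE_iff_null_sets)
    qed
    then show "absolutely_continuous (density \<mu> h) \<mu>"
      using h(1) by (auto simp: absolutely_continuous_def null_sets_density_iff)
  qed simp
qed

text \<open>The sum of two finite substitutes is finite, hence sigma-finite, and a set is null for
  the sum only if it is null for both.\<close>

lemma ex_dominating_measure2:
  assumes "sfm S \<mu>" "sfm S \<nu>"
  obtains \<tau> where "sfm S \<tau>" "absolutely_continuous \<tau> \<mu>" "absolutely_continuous \<tau> \<nu>"
proof -
  obtain \<mu>' where \<mu>': "sets \<mu>' = sets S" "finite_measure \<mu>'" "absolutely_continuous \<mu>' \<mu>"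
    using ex_equivalent_finite_measure[of \<mu>] assms(1) by (auto simp: sfm_def)
  obtain \<nu>' where \<nu>': "sets \<nu>' = sets S" "finite_measure \<nu>'" "absolutely_continuous \<nu>' \<nu>"
    using ex_equivalent_finite_measure[of \<nu>] assms(2) by (auto simp: sfm_def)
  define \<tau> where "\<tau> = measure_of (space S) (sets S) (\<lambda>A. emeasure \<mu>' A + emeasure \<nu>' A)"
  have sets: "sets \<tau> = sets S" by (simp add: \<tau>_def)
  have em: "emeasure \<tau> A = emeasure \<mu>' A + emeasure \<nu>' A" if "A \<in> sets S" for A
  proof (rule emeasure_measure_of[OF \<tau>_def])
    show "countably_additive (sets \<tau>) (\<lambda>A. emeasure \<mu>' A + emeasure \<nu>' A)"
      unfolding countably_additive_def
      by (auto simp: sets \<mu>'(1) \<nu>'(1) suminf_add[symmetric] suminf_emeasure)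
  qed (use that sets.space_closed in \<open>auto simp: positive_def sets\<close>)
  show ?thesis
  proof
    have "finite_measure \<tau>"
    proof (rule finite_measureI)
      have "space \<tau> \<in> sets S" using sets by auto
      then show "emeasure \<tau> (space \<tau>) \<noteq> \<infinity>"
        using \<mu>'(2) \<nu>'(2) by (simp add: em finite_measure.emeasure_finite)
    qed
    then interpret finite_measure \<tau> .
    show "sfm S \<tau>" unfolding sfm_def using sets sigma_finite_measure_axioms by simp
    have "absolutely_continuous \<tau> \<mu>'" "absolutely_continuous \<tau> \<nu>'"
      using em sets \<mu>'(1) \<nu>'(1) by (auto simp: absolutely_continuous_def null_sets_def)
    then show "absolutely_continuous \<tau> \<mu>" "absolutely_continuous \<tau> \<nu>"
      using \<mu>'(3) \<nu>'(3) absolutely_continuous_trans by blast+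
  qed
qed

lemma ex_dominating_measure:
  assumes "finite J" "\<And>i. i \<in> J \<Longrightarrow> sfm S (\<mu> i)" "sfm S \<nu>"
  shows "\<exists>\<tau>. sfm S \<tau> \<and> absolutely_continuous \<tau> \<nu> \<and> (\<forall>i\<in>J. absolutely_continuous \<tau> (\<mu> i))"
  using assms(1,2)
proof (induction J)
  case empty
  then show ?case using assms(3) absolutely_continuous_refl by blast
next
  case (insert i J)
  then obtain \<tau> where \<tau>: "sfm S \<tau>" "absolutely_continuous \<tau> \<nu>" "\<forall>i\<in>J. absolutely_continuous \<tau> (\<mu> i)"
    by auto
  obtain \<tau>' where "sfm S \<tau>'" "absolutely_continuous \<tau>' \<tau>" "absolutely_continuous \<tau>' (\<mu> i)"
    using ex_dominating_measure2[OF \<tau>(1) insert.prems[of i]] by blast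
  with \<tau> show ?case using absolutely_continuous_trans by blast
qed

section \<open>Lifting representatives to a dominating measure\<close>

text \<open>When \<open>\<nu>\<close> dominates \<open>\<mu>\<close>, this is the function that
  represents the vector of (\<open>f\<close>, \<open>\<mu>\<close>) over the measure
  \<open>\<nu>\<close>.\<close>

definition ulift :: "'a measure \<Rightarrow> ('a \<Rightarrow> complex) \<Rightarrow> 'a measure \<Rightarrow> 'a \<Rightarrow> complex" where
  "ulift \<nu> f \<mu> x = f x * sqrt_deriv \<nu> \<mu> x"

lemma borel_measurable_sqrt_deriv [measurable]: "sqrt_deriv \<nu> \<mu> \<in> borel_measurable \<nu>"
  unfolding sqrt_deriv_def[abs_def] by measurable

lemma cnj_sqrt_deriv: "cnj (sqrt_deriv \<nu> \<mu> x) = sqrt_deriv \<nu> \<mu> x"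
  by (simp add: sqrt_deriv_def)

lemma borel_measurable_ulift:
  assumes "sfm S \<nu>" "(f, \<mu>) \<in> upairs S"
  shows "ulift \<nu> f \<mu> \<in> borel_measurable \<nu>"
proof -
  have "sets \<nu> = sets \<mu>" using assms by (auto simp: sfm_def upairs_def)
  then have "f \<in> borel_measurable \<nu>"
    using assms(2) L2_measurable[of f \<mu>] by (simp add: upairs_def cong: measurable_cong_sets)
  then show ?thesis unfolding ulift_def[abs_def] by measurable
qed

text \<open>Since \<open>\<nu>\<close> is sigma-finite, the Radon-Nikodym derivative is finite
  almost everywhere, so the passage through \<open>enn2real\<close> in \<open>sqrt_deriv\<close>
  loses nothing.\<close>

lemma density_sqrt_deriv:
  assumes "sfm S \<tau>" "sfm S \<nu>" "absolutely_continuous \<tau> \<nu>"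
  shows "\<nu> = density \<tau> (\<lambda>x. ennreal ((cmod (sqrt_deriv \<tau> \<nu> x))\<^sup>2))"
proof -
  interpret sigma_finite_measure \<tau> using assms(1) by (simp add: sfm_def)
  have sets: "sets \<nu> = sets \<tau>" "sigma_finite_measure \<nu>" using assms by (auto simp: sfm_def)
  have "AE x in \<tau>. RN_deriv \<tau> \<nu> x \<noteq> \<infinity>"
    by (rule RN_deriv_finite[OF sets(2) assms(3) sets(1)])
  then have "AE x in \<tau>. RN_deriv \<tau> \<nu> x = ennreal ((cmod (sqrt_deriv \<tau> \<nu> x))\<^sup>2)"
    by eventually_elim (simp add: sqrt_deriv_def top.not_eq_extremum)
  then have "density \<tau> (RN_deriv \<tau> \<nu>) = density \<tau> (\<lambda>x. ennreal ((cmod (sqrt_deriv \<tau> \<nu> x))\<^sup>2))"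
    by (intro density_cong) auto
  then show ?thesis using density_RN_deriv[OF assms(3) sets(1)] by simp
qed

text \<open>\<open>\<tau>\<close> may charge sets that are null for \<open>\<nu>\<close>, but there
  the density of \<open>\<nu>\<close> vanishes almost everywhere.\<close>

lemma AE_sqrt_deriv:
  assumes "sfm S \<tau>" "sfm S \<nu>" "absolutely_continuous \<tau> \<nu>" "AE x in \<nu>. P x"
  shows "AE x in \<tau>. sqrt_deriv \<tau> \<nu> x \<noteq> 0 \<longrightarrow> P x"
proof -
  have "AE x in density \<tau> (\<lambda>x. ennreal ((cmod (sqrt_deriv \<tau> \<nu> x))\<^sup>2)). P x"
    using assms(4) by (subst density_sqrt_deriv[OF assms(1-3), symmetric])
  then show ?thesis by (subst (asm) AE_density) auto
qed

text \<open>The product of the two derivatives is a density of \<open>\<mu>\<close> with respect to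
  \<open>\<tau>\<close>, so uniqueness of the Radon-Nikodym derivative gives the chain rule; square
  roots are taken pointwise.\<close>

lemma sqrt_deriv_chain:
  assumes "sfm S \<tau>" "sfm S \<nu>" "sfm S \<mu>" "absolutely_continuous \<tau> \<nu>" "absolutely_continuous \<nu> \<mu>"
  shows "AE x in \<tau>. sqrt_deriv \<nu> \<mu> x * sqrt_deriv \<tau> \<nu> x = sqrt_deriv \<tau> \<mu> x"
proof -
  interpret \<tau>: sigma_finite_measure \<tau> using assms(1) by (simp add: sfm_def)
  interpret \<nu>: sigma_finite_measure \<nu> using assms(2) by (simp add: sfm_def)
  have sets: "sets \<nu> = sets \<tau>" "sets \<mu> = sets \<nu>" using assms by (auto simp: sfm_def)
  have [measurable]: "RN_deriv \<nu> \<mu> \<in> borel_measurable \<tau>"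
    using borel_measurable_RN_deriv[of \<nu> \<mu>] sets(1) by (simp cong: measurable_cong_sets)
  have "density \<tau> (\<lambda>x. RN_deriv \<tau> \<nu> x * RN_deriv \<nu> \<mu> x) = density (density \<tau> (RN_deriv \<tau> \<nu>)) (RN_deriv \<nu> \<mu>)"
    by (subst density_density_eq) auto
  also have "\<dots> = \<mu>"
    using assms sets by (simp add: \<tau>.density_RN_deriv \<nu>.density_RN_deriv)
  finally have "AE x in \<tau>. RN_deriv \<tau> \<nu> x * RN_deriv \<nu> \<mu> x = RN_deriv \<tau> \<mu> x"
    by (intro \<tau>.RN_deriv_unique) auto
  then show ?thesis
  proof eventually_elim
    case (elim x)
    show ?case unfolding sqrt_deriv_def elim[symmetric]
      by (simp add: enn2real_mult real_sqrt_mult mult.commute)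
  qed
qed

lemma ulift_L2:
  assumes "sfm S \<tau>" "(f, \<mu>) \<in> upairs S" "absolutely_continuous \<tau> \<mu>"
  shows "ulift \<tau> f \<mu> \<in> L2 \<tau>"
proof -
  have \<mu>: "sfm S \<mu>" and f: "f \<in> L2 \<mu>" using assms(2) by (auto simp: upairs_def)
  have "sets \<tau> = sets \<mu>" using assms(1) \<mu> by (auto simp: sfm_def)
  then have [measurable]: "f \<in> borel_measurable \<tau>"
    using L2_measurable[OF f] by (simp cong: measurable_cong_sets)
  have "integrable (density \<tau> (\<lambda>x. ennreal ((cmod (sqrt_deriv \<tau> \<mu> x))\<^sup>2))) (\<lambda>x. (cmod (f x))\<^sup>2)"
    using L2_integrable_sq[OF f] by (subst density_sqrt_deriv[OF assms(1) \<mu> assms(3), symmetric])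
  then have "integrable \<tau> (\<lambda>x. (cmod (ulift \<tau> f \<mu> x))\<^sup>2)"
    by (subst (asm) integrable_density) (auto simp: ulift_def norm_mult power_mult_distrib mult.commute)
  then show ?thesis using borel_measurable_ulift[OF assms(1,2)] by (simp add: L2_def)
qed

text \<open>Lifting is isometric: the two real square roots multiply to the density of
  \<open>\<mu>\<close> with respect to \<open>\<tau>\<close>.\<close>

lemma l2inner_ulift:
  assumes "sfm S \<tau>" "(f, \<mu>) \<in> upairs S" "(g, \<mu>) \<in> upairs S" "absolutely_continuous \<tau> \<mu>"
  shows "l2inner \<tau> (ulift \<tau> f \<mu>) (ulift \<tau> g \<mu>) = l2inner \<mu> f g"
proof -
  have \<mu>: "sfm S \<mu>" and fg: "f \<in> L2 \<mu>" "g \<in> L2 \<mu>" using assms(2,3) by (auto simp: upairs_def)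
  have "sets \<tau> = sets \<mu>" using assms(1) \<mu> by (auto simp: sfm_def)
  then have [measurable]: "f \<in> borel_measurable \<tau>" "g \<in> borel_measurable \<tau>"
    using fg[THEN L2_measurable] by (simp_all cong: measurable_cong_sets)
  have "l2inner \<mu> f g = l2inner (density \<tau> (\<lambda>x. ennreal ((cmod (sqrt_deriv \<tau> \<mu> x))\<^sup>2))) f g"
    by (subst density_sqrt_deriv[OF assms(1) \<mu> assms(4), symmetric]) simp
  also have "\<dots> = (LINT x|\<tau>. (cmod (sqrt_deriv \<tau> \<mu> x))\<^sup>2 *\<^sub>R (f x * cnj (g x)))"
    unfolding l2inner_def by (rule integral_density) auto
  also have "\<dots> = l2inner \<tau> (ulift \<tau> f \<mu>) (ulift \<tau> g \<mu>)"
    unfolding l2inner_def ulift_def scaleR_conv_of_real complex_norm_square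
    by (simp add: mult_ac)
  finally show ?thesis by simp
qed

lemma upairs_ulift:
  assumes "sfm S \<tau>" "(f, \<mu>) \<in> upairs S" "absolutely_continuous \<tau> \<mu>"
  shows "(ulift \<tau> f \<mu>, \<tau>) \<in> upairs S"
  using ulift_L2[OF assms] assms(1) by (simp add: upairs_def)

lemma ulift_ulift:
  assumes "sfm S \<tau>" "sfm S \<nu>" "(f, \<mu>) \<in> upairs S" "absolutely_continuous \<tau> \<nu>" "absolutely_continuous \<nu> \<mu>"
  shows "AE x in \<tau>. ulift \<tau> (ulift \<nu> f \<mu>) \<nu> x = ulift \<tau> f \<mu> x"
  using sqrt_deriv_chain[OF assms(1,2) _ assms(4,5)] assms(3)
  by (auto simp: ulift_def upairs_def mult.assoc elim!: eventually_mono)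

text \<open>Enlarging the dominating measure does not change the inner product: lift isometrically
  from \<open>\<nu>\<close> to \<open>\<tau>\<close> and merge the two lifts by the chain
  rule.\<close>

lemma l2inner_ulift_change:
  assumes "sfm S \<tau>" "absolutely_continuous \<tau> \<nu>" "dominates S \<nu> \<mu> \<kappa>"
    and f: "(f, \<mu>) \<in> upairs S" and g: "(g, \<kappa>) \<in> upairs S"
  shows "l2inner \<nu> (ulift \<nu> f \<mu>) (ulift \<nu> g \<kappa>) = l2inner \<tau> (ulift \<tau> f \<mu>) (ulift \<tau> g \<kappa>)"
proof -
  have \<nu>: "sfm S \<nu>" "absolutely_continuous \<nu> \<mu>" "absolutely_continuous \<nu> \<kappa>"
    using assms(3) by (auto simp: dominates_def)
  note up = upairs_ulift[OF \<nu>(1) f \<nu>(2)] upairs_ulift[OF \<nu>(1) g \<nu>(3)]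
  have "l2inner \<nu> (ulift \<nu> f \<mu>) (ulift \<nu> g \<kappa>)
      = l2inner \<tau> (ulift \<tau> (ulift \<nu> f \<mu>) \<nu>) (ulift \<tau> (ulift \<nu> g \<kappa>) \<nu>)"
    using l2inner_ulift[OF assms(1) up assms(2)] by simp
  also have "\<dots> = l2inner \<tau> (ulift \<tau> f \<mu>) (ulift \<tau> g \<kappa>)"
    using assms(1,2) \<nu> f g up by (intro l2inner_cong_AE borel_measurable_ulift ulift_ulift) auto
  finally show ?thesis .
qed

section \<open>The inner product of classes\<close>

text \<open>Equality over the witness \<open>\<nu>\<close> passes to any larger
  \<open>\<tau>\<close>: where the density of \<open>\<nu>\<close> vanishes both lifts are 0,
  elsewhere the given equality applies. Quantifying over all such \<open>\<tau>\<close> lets the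
  witnesses of several equivalences be merged.\<close>

lemma uequiv_ulift:
  assumes "((f, \<mu>), (g, \<kappa>)) \<in> uequiv S"
  obtains \<nu> where "sfm S \<nu>"
    "\<And>\<tau>. sfm S \<tau> \<Longrightarrow> absolutely_continuous \<tau> \<nu> \<Longrightarrow> AE x in \<tau>. ulift \<tau> f \<mu> x = ulift \<tau> g \<kappa> x"
proof -
  from assms obtain \<nu> where up: "(f, \<mu>) \<in> upairs S" "(g, \<kappa>) \<in> upairs S"
    and \<nu>: "sfm S \<nu>" "absolutely_continuous \<nu> \<mu>" "absolutely_continuous \<nu> \<kappa>"
    and eq: "AE x in \<nu>. ulift \<nu> f \<mu> x = ulift \<nu> g \<kappa> x"
    by (auto simp: uequiv_def dominates_def ulift_def)
  have "AE x in \<tau>. ulift \<tau> f \<mu> x = ulift \<tau> g \<kappa> x" if \<tau>: "sfm S \<tau>" "absolutely_continuous \<tau> \<nu>" for \<tau>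
    using ulift_ulift[OF \<tau>(1) \<nu>(1) up(1) \<tau>(2) \<nu>(2)] ulift_ulift[OF \<tau>(1) \<nu>(1) up(2) \<tau>(2) \<nu>(3)]
      AE_sqrt_deriv[OF \<tau>(1) \<nu>(1) \<tau>(2) eq]
  proof eventually_elim
    case (elim x)
    then show ?case unfolding ulift_def[of \<tau> "ulift \<nu> _ _" \<nu>] by (metis mult_zero_right)
  qed
  with \<nu>(1) show ?thesis by (rule that)
qed

lemma mem_uclass:
  assumes "(f, \<mu>) \<in> upairs S"
  shows "(f, \<mu>) \<in> uclass S f \<mu>"
  using assms absolutely_continuous_refl[of \<mu>]
  by (auto simp: uclass_def uequiv_def dominates_def upairs_def intro!: exI[of _ \<mu>])

text \<open>The definite description in \<open>uinner\<close> is meaningful only if the integral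
  does not depend on representatives or dominating measure. Any two choices are compared over one
  measure dominating both of these and both equivalence witnesses.\<close>

lemma uinner_uclass:
  assumes f: "(f, \<mu>) \<in> upairs S" and g: "(g, \<kappa>) \<in> upairs S" and \<nu>: "dominates S \<nu> \<mu> \<kappa>"
  shows "uinner S (uclass S f \<mu>) (uclass S g \<kappa>) = l2inner \<nu> (ulift \<nu> f \<mu>) (ulift \<nu> g \<kappa>)"
proof -
  have body: "(LINT x|\<nu>. f1 x * cnj (f2 x) * sqrt_deriv \<nu> \<mu>1 x * sqrt_deriv \<nu> \<mu>2 x)
      = l2inner \<nu> (ulift \<nu> f1 \<mu>1) (ulift \<nu> f2 \<mu>2)" for \<nu> f1 f2 \<mu>1 \<mu>2
    by (simp add: l2inner_def ulift_def cnj_sqrt_deriv mult_ac)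
  have unique: "l2inner \<nu>' (ulift \<nu>' f1 \<mu>1) (ulift \<nu>' f2 \<mu>2) = l2inner \<nu> (ulift \<nu> f \<mu>) (ulift \<nu> g \<kappa>)"
    if "(f1, \<mu>1) \<in> uclass S f \<mu>" "(f2, \<mu>2) \<in> uclass S g \<kappa>" "dominates S \<nu>' \<mu>1 \<mu>2" for f1 \<mu>1 f2 \<mu>2 \<nu>'
  proof -
    have eq: "((f, \<mu>), (f1, \<mu>1)) \<in> uequiv S" "((g, \<kappa>), (f2, \<mu>2)) \<in> uequiv S"
      using that by (auto simp: uclass_def)
    then have up: "(f1, \<mu>1) \<in> upairs S" "(f2, \<mu>2) \<in> upairs S" by (auto simp: uequiv_def)
    obtain \<nu>1 where \<nu>1: "sfm S \<nu>1" "\<And>\<tau>. sfm S \<tau> \<Longrightarrow> absolutely_continuous \<tau> \<nu>1 \<Longrightarrow>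
        AE x in \<tau>. ulift \<tau> f \<mu> x = ulift \<tau> f1 \<mu>1 x"
      using uequiv_ulift[OF eq(1)] by blast
    obtain \<nu>2 where \<nu>2: "sfm S \<nu>2" "\<And>\<tau>. sfm S \<tau> \<Longrightarrow> absolutely_continuous \<tau> \<nu>2 \<Longrightarrow>
        AE x in \<tau>. ulift \<tau> g \<kappa> x = ulift \<tau> f2 \<mu>2 x"
      using uequiv_ulift[OF eq(2)] by blast
    have "sfm S \<nu>" "sfm S \<nu>'" using \<nu> that(3) by (auto simp: dominates_def)
    then obtain \<tau> where \<tau>: "sfm S \<tau>" "absolutely_continuous \<tau> \<nu>" "absolutely_continuous \<tau> \<nu>'"
        "absolutely_continuous \<tau> \<nu>1" "absolutely_continuous \<tau> \<nu>2"
      using ex_dominating_measure[of "{\<nu>', \<nu>1, \<nu>2}" S "\<lambda>x. x" \<nu>] \<nu>1(1) \<nu>2(1) by auto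
    have "l2inner \<nu>' (ulift \<nu>' f1 \<mu>1) (ulift \<nu>' f2 \<mu>2) = l2inner \<tau> (ulift \<tau> f1 \<mu>1) (ulift \<tau> f2 \<mu>2)"
      by (rule l2inner_ulift_change[OF \<tau>(1,3) that(3) up])
    also have "\<dots> = l2inner \<tau> (ulift \<tau> f \<mu>) (ulift \<tau> g \<kappa>)"
      using \<nu>1(2)[OF \<tau>(1,4)] \<nu>2(2)[OF \<tau>(1,5)] \<tau>(1) up f g
      by (intro l2inner_cong_AE borel_measurable_ulift) auto
    also have "\<dots> = l2inner \<nu> (ulift \<nu> f \<mu>) (ulift \<nu> g \<kappa>)"
      by (rule l2inner_ulift_change[OF \<tau>(1,2) \<nu> f g, symmetric])
    finally show ?thesis .
  qed
  show ?thesis unfolding uinner_def body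
    using mem_uclass[OF f] mem_uclass[OF g] \<nu> unique by (intro the_equality) blast+
qed

text \<open>Both vectors are represented over the same \<open>\<mu>\<close>, so the combination is
  formed on functions directly; this is the linearity behind that of the map taking \<open>f\<close>
  to its white noise.\<close>

lemma uinner_uclass_lincomb:
  assumes "sfm S \<mu>" "f \<in> L2 \<mu>" "g \<in> L2 \<mu>" "(h, \<kappa>) \<in> upairs S"
  shows "uinner S (uclass S (\<lambda>x. a * f x + b * g x) \<mu>) (uclass S h \<kappa>) =
    a * uinner S (uclass S f \<mu>) (uclass S h \<kappa>) + b * uinner S (uclass S g \<mu>) (uclass S h \<kappa>)"
proof -
  have "sfm S \<kappa>" using assms(4) by (simp add: upairs_def)
  from ex_dominating_measure2[OF assms(1) this] obtain \<nu> where "dominates S \<nu> \<mu> \<kappa>"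
    and \<nu>: "sfm S \<nu>" "absolutely_continuous \<nu> \<mu>" "absolutely_continuous \<nu> \<kappa>"
    unfolding dominates_def by blast
  have up: "(f, \<mu>) \<in> upairs S" "(g, \<mu>) \<in> upairs S" "(\<lambda>x. a * f x + b * g x, \<mu>) \<in> upairs S"
    using assms by (auto simp: upairs_def L2_lincomb)
  have "ulift \<nu> (\<lambda>x. a * f x + b * g x) \<mu> = (\<lambda>x. a * ulift \<nu> f \<mu> x + b * ulift \<nu> g \<mu> x)"
    by (auto simp: ulift_def algebra_simps)
  then show ?thesis
    using up assms(4) \<open>dominates S \<nu> \<mu> \<kappa>\<close> \<nu>
    by (simp add: uinner_uclass[of _ _ _ _ _ \<nu>] l2inner_lincomb_left ulift_L2)
qed

lemma uinner_real:
  assumes f: "(f, \<mu>) \<in> upairs S" "\<And>x. x \<in> space S \<Longrightarrow> f x \<in> \<real>"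
    and g: "(g, \<kappa>) \<in> upairs S" "\<And>x. x \<in> space S \<Longrightarrow> g x \<in> \<real>"
  shows "cnj (uinner S (uclass S f \<mu>) (uclass S g \<kappa>)) = uinner S (uclass S f \<mu>) (uclass S g \<kappa>)"
proof -
  have "sfm S \<mu>" "sfm S \<kappa>" using f g by (auto simp: upairs_def)
  from ex_dominating_measure2[OF this] obtain \<nu> where \<nu>: "dominates S \<nu> \<mu> \<kappa>" "sfm S \<nu>"
    unfolding dominates_def by blast
  have "space \<nu> = space S" using \<nu>(2) sets_eq_imp_space_eq[of \<nu> S] by (simp add: sfm_def)
  \<comment> \<open>Real integrands make the inner product symmetric, and Hermitian symmetry then
    makes it real.\<close>
  then have "l2inner \<nu> (ulift \<nu> f \<mu>) (ulift \<nu> g \<kappa>) = l2inner \<nu> (ulift \<nu> g \<kappa>) (ulift \<nu> f \<mu>)"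
    unfolding l2inner_def ulift_def using f(2) g(2)
    by (intro Bochner_Integration.integral_cong) (auto simp: cnj_sqrt_deriv Reals_cnj_iff mult_ac)
  then show ?thesis
    unfolding uinner_uclass[OF f(1) g(1) \<nu>(1)] by (metis l2inner_commute)
qed

section \<open>Parseval's identity and Bessel's inequality for finite families\<close>

lemma l2_Parseval_finite:
  assumes "finite J" "\<And>i. i \<in> J \<Longrightarrow> \<phi> i \<in> L2 M"
    and on: "\<And>i j. i \<in> J \<Longrightarrow> j \<in> J \<Longrightarrow> l2inner M (\<phi> i) (\<phi> j) = (if i = j then 1 else 0)"
  shows "(l2norm M (\<lambda>x. \<Sum>i\<in>J. c i * \<phi> i x))\<^sup>2 = (\<Sum>i\<in>J. (cmod (c i))\<^sup>2)"
proof -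
  define p where "p x = (\<Sum>i\<in>J. c i * \<phi> i x)" for x
  have p: "p \<in> L2 M" unfolding p_def[abs_def] using assms(2) by (rule L2_sum)
  have ip: "l2inner M p g = (\<Sum>i\<in>J. c i * l2inner M (\<phi> i) g)" if "g \<in> L2 M" for g
    unfolding p_def[abs_def] using assms(2) that by (rule l2inner_sum_left)
  have "l2inner M p (\<phi> i) = c i" if "i \<in> J" for i
    using that assms(1,2) by (simp add: ip on if_distrib[of "(*) _"] cong: if_cong)
  then have "l2inner M (\<phi> i) p = cnj (c i)" if "i \<in> J" for i
    using that by (subst l2inner_commute) simp
  then have "l2inner M p p = (\<Sum>i\<in>J. c i * cnj (c i))"
    unfolding ip[OF p] by (intro sum.cong) auto
  then show ?thesis
    unfolding l2inner_self complex_norm_square[symmetric] of_real_sum[symmetric] of_real_eq_iff p_def .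
qed

text \<open>With \<open>p\<close> the orthogonal projection of \<open>f\<close>, both the pairing of
  \<open>f\<close> with \<open>p\<close> and the squared norm of \<open>p\<close> equal
  \<open>s\<close>, so the squared distance of \<open>f\<close> and \<open>p\<close> is the squared
  norm of \<open>f\<close> minus \<open>s\<close>.\<close>

lemma l2_Bessel:
  assumes "finite J" "\<And>i. i \<in> J \<Longrightarrow> \<phi> i \<in> L2 M" "f \<in> L2 M"
    and on: "\<And>i j. i \<in> J \<Longrightarrow> j \<in> J \<Longrightarrow> l2inner M (\<phi> i) (\<phi> j) = (if i = j then 1 else 0)"
  shows "(\<Sum>i\<in>J. (cmod (l2inner M f (\<phi> i)))\<^sup>2) \<le> (l2norm M f)\<^sup>2"
proof -
  define c where "c i = l2inner M f (\<phi> i)" for i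
  define p where "p x = (\<Sum>i\<in>J. c i * \<phi> i x)" for x
  define s where "s = (\<Sum>i\<in>J. (cmod (c i))\<^sup>2)"
  have p: "p \<in> L2 M" unfolding p_def[abs_def] using assms(2) by (rule L2_sum)
  have "l2inner M p f = (\<Sum>i\<in>J. c i * l2inner M (\<phi> i) f)"
    unfolding p_def[abs_def] using assms(2,3) by (rule l2inner_sum_left)
  also have "\<dots> = (\<Sum>i\<in>J. c i * cnj (c i))"
    using l2inner_commute[of M _ f] by (simp add: c_def)
  also have "\<dots> = complex_of_real s"
    unfolding s_def of_real_sum complex_norm_square ..
  finally have pf: "l2inner M f p = complex_of_real s" by (subst l2inner_commute) simp
  have "(l2norm M p)\<^sup>2 = s"
    unfolding p_def[abs_def] s_def by (rule l2_Parseval_finite) (use assms in auto)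
  then have "0 \<le> (l2norm M f)\<^sup>2 - s"
    using l2norm_lincomb_sq[OF assms(3) p, of 1 "-1"] pf zero_le_power2[of "l2norm M (\<lambda>x. f x - p x)"]
    by simp
  then show ?thesis by (simp add: s_def c_def)
qed

text \<open>One measure dominates \<open>\<mu>\<close> and the measures of the finitely many
  representatives; over it the statement is Bessel's inequality for functions.\<close>

lemma uinner_Bessel:
  assumes "finite J" "\<And>i. i \<in> J \<Longrightarrow> real_class S (e i)" "sfm S \<mu>" "f \<in> L2 \<mu>"
    and on: "\<And>i j. i \<in> J \<Longrightarrow> j \<in> J \<Longrightarrow> uinner S (e i) (e j) = (if i = j then 1 else 0)"
  shows "(\<Sum>i\<in>J. (cmod (uinner S (uclass S f \<mu>) (e i)))\<^sup>2) \<le> (l2norm \<mu> f)\<^sup>2"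
proof -
  have "\<exists>p. p \<in> upairs S \<and> e i = uclass S (fst p) (snd p)" if "i \<in> J" for i
    using assms(2)[OF that] unfolding real_class_def by force
  then obtain p where p: "\<forall>i\<in>J. p i \<in> upairs S \<and> e i = uclass S (fst (p i)) (snd (p i))"
    using bchoice[of J "\<lambda>i p. p \<in> upairs S \<and> e i = uclass S (fst p) (snd p)"] by blast
  define g \<kappa> where "g i = fst (p i)" and "\<kappa> i = snd (p i)" for i
  have e: "(g i, \<kappa> i) \<in> upairs S" "e i = uclass S (g i) (\<kappa> i)" if "i \<in> J" for i
    using p that by (auto simp: g_def \<kappa>_def)
  then have "sfm S (\<kappa> i)" if "i \<in> J" for i using that by (force simp: upairs_def)
  then obtain \<tau> where \<tau>: "sfm S \<tau>" "absolutely_continuous \<tau> \<mu>" "\<And>i. i \<in> J \<Longrightarrow> absolutely_continuous \<tau> (\<kappa> i)"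
    using ex_dominating_measure[OF assms(1) _ assms(3), of \<kappa>] by blast
  have f: "(f, \<mu>) \<in> upairs S" using assms by (simp add: upairs_def)
  define \<phi> where "\<phi> i = ulift \<tau> (g i) (\<kappa> i)" for i
  have "(\<Sum>i\<in>J. (cmod (l2inner \<tau> (ulift \<tau> f \<mu>) (\<phi> i)))\<^sup>2) \<le> (l2norm \<tau> (ulift \<tau> f \<mu>))\<^sup>2"
  proof (rule l2_Bessel[OF assms(1)])
    show "\<phi> i \<in> L2 \<tau>" if "i \<in> J" for i
      unfolding \<phi>_def using \<tau> e(1) that by (intro ulift_L2) auto
    show "ulift \<tau> f \<mu> \<in> L2 \<tau>" by (rule ulift_L2[OF \<tau>(1) f \<tau>(2)])
    show "l2inner \<tau> (\<phi> i) (\<phi> j) = (if i = j then 1 else 0)" if "i \<in> J" "j \<in> J" for i j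
      using on[OF that] uinner_uclass[OF e(1)[OF that(1)] e(1)[OF that(2)], of \<tau>] that \<tau> e(2)
      by (simp add: \<phi>_def dominates_def)
  qed
  moreover have "uinner S (uclass S f \<mu>) (e i) = l2inner \<tau> (ulift \<tau> f \<mu>) (\<phi> i)" if "i \<in> J" for i
    using uinner_uclass[OF f e(1)[OF that], of \<tau>] that \<tau> e(2) by (simp add: \<phi>_def dominates_def)
  moreover have "(l2norm \<tau> (ulift \<tau> f \<mu>))\<^sup>2 = (l2norm \<mu> f)\<^sup>2"
    using l2inner_ulift[OF \<tau>(1) f f \<tau>(2)] unfolding l2inner_self of_real_eq_iff .
  ultimately show ?thesis by simp
qed

section \<open>Gaussian series\<close>

text \<open>\<open>I\<close> may be uncountable, so convergence is along a net, whereas completeness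
  is sequential. The limit is found along a sequence of finite sets \<open>L n\<close> that exhausts
  the tail estimates, and the net is then compared with that sequence.\<close>

lemma l2_orthonormal_series:
  fixes \<phi> :: "'i \<Rightarrow> 'a \<Rightarrow> complex" and c :: "'i \<Rightarrow> complex"
  assumes \<phi>: "\<And>i. i \<in> I \<Longrightarrow> \<phi> i \<in> L2 M"
    and on: "\<And>i j. i \<in> I \<Longrightarrow> j \<in> I \<Longrightarrow> l2inner M (\<phi> i) (\<phi> j) = (if i = j then 1 else 0)"
    and B: "\<And>J. finite J \<Longrightarrow> J \<subseteq> I \<Longrightarrow> (\<Sum>i\<in>J. (cmod (c i))\<^sup>2) \<le> B"
  shows "\<exists>w. w \<in> L2 M \<and>
    ((\<lambda>J. l2norm M (\<lambda>x. (\<Sum>i\<in>J. c i * \<phi> i x) - w x)) \<longlongrightarrow> 0) (finite_subsets_at_top I)"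
proof -
  define a where "a i = (cmod (c i))\<^sup>2" for i
  define s where "s J x = (\<Sum>i\<in>J. c i * \<phi> i x)" for J x
  have s: "s J \<in> L2 M" if "J \<subseteq> I" for J
    unfolding s_def[abs_def] using \<phi> that by (intro L2_sum) auto
  \<comment> \<open>Nesting makes the difference a sum over \<open>J\<close> - \<open>K\<close>, to
    which Parseval applies.\<close>
  have s_diff: "(l2norm M (\<lambda>x. s J x - s K x))\<^sup>2 = sum a J - sum a K"
    if "finite J" "J \<subseteq> I" "K \<subseteq> J" for J K
  proof -
    have "s J x - s K x = (\<Sum>i\<in>J - K. c i * \<phi> i x)" for x
      unfolding s_def using that by (subst sum_diff) auto
    then have "(l2norm M (\<lambda>x. s J x - s K x))\<^sup>2 = sum a (J - K)"
      unfolding a_def using that(1) subsetD[OF that(2)] \<phi> on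
      by (subst l2_Parseval_finite[symmetric, where M = M and \<phi> = \<phi>]) simp_all
    then show ?thesis using that by (simp add: sum_diff)
  qed
  have "a summable_on I"
    by (rule nonneg_bdd_above_summable_on) (auto simp: a_def intro!: bdd_aboveI[of _ B] B)
  then have "(a has_sum infsum a I) I" by (rule has_sum_infsum)
  then have lim: "(sum a \<longlongrightarrow> infsum a I) (finite_subsets_at_top I)"
    by (simp add: has_sum_def)
  have tail: "\<exists>K. finite K \<and> K \<subseteq> I \<and> (\<forall>J. finite J \<longrightarrow> K \<subseteq> J \<longrightarrow> J \<subseteq> I \<longrightarrow> l2norm M (\<lambda>x. s J x - s K x) < \<epsilon>)"
    if "\<epsilon> > 0" for \<epsilon>
  proof -
    have "\<epsilon>\<^sup>2 / 2 > 0" using that by simp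
    from tendstoD[OF lim this, unfolded eventually_finite_subsets_at_top]
    obtain K where K: "finite K" "K \<subseteq> I"
      and "\<forall>J. finite J \<and> K \<subseteq> J \<and> J \<subseteq> I \<longrightarrow> dist (sum a J) (infsum a I) < \<epsilon>\<^sup>2 / 2"
      by (elim exE conjE)
    then have *: "dist (sum a J) (infsum a I) < \<epsilon>\<^sup>2 / 2" if "finite J" "K \<subseteq> J" "J \<subseteq> I" for J
      using that by simp
    have "l2norm M (\<lambda>x. s J x - s K x) < \<epsilon>" if J: "finite J" "K \<subseteq> J" "J \<subseteq> I" for J
    proof (rule power_less_imp_less_base)
      have "sum a J - sum a K < \<epsilon>\<^sup>2 / 2 + \<epsilon>\<^sup>2 / 2"
        using *[OF J] *[OF K(1) order_refl K(2)] unfolding dist_real_def by linarith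
      then show "(l2norm M (\<lambda>x. s J x - s K x))\<^sup>2 < \<epsilon>\<^sup>2"
        using s_diff[OF J(1,3,2)] by simp
    qed (use \<open>\<epsilon> > 0\<close> in simp)
    with K show ?thesis by blast
  qed
  have "\<exists>K. finite K \<and> K \<subseteq> I \<and> (\<forall>J. finite J \<longrightarrow> K \<subseteq> J \<longrightarrow> J \<subseteq> I \<longrightarrow> l2norm M (\<lambda>x. s J x - s K x) < 1 / real (Suc n))" for n
    by (rule tail) simp
  then obtain K where K: "\<And>n. finite (K n)" "\<And>n. K n \<subseteq> I"
    "\<And>n J. finite J \<Longrightarrow> K n \<subseteq> J \<Longrightarrow> J \<subseteq> I \<Longrightarrow> l2norm M (\<lambda>x. s J x - s (K n) x) < 1 / real (Suc n)"
    by metis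
  \<comment> \<open>Finite unions make the sets increase, so that \<open>L n\<close> contains
    \<open>K N\<close> for every \<open>N\<close> up to \<open>n\<close>.\<close>
  define L where "L n = (\<Union>k\<le>n. K k)" for n
  have L: "finite (L n)" "L n \<subseteq> I" "N \<le> n \<Longrightarrow> K N \<subseteq> L n" for n N
    using K(1,2) by (auto simp: L_def)
  have close: "l2norm M (\<lambda>x. s J x - s J' x) < 2 / real (Suc N)"
    if "finite J" "K N \<subseteq> J" "J \<subseteq> I" "finite J'" "K N \<subseteq> J'" "J' \<subseteq> I" for J J' N
    using l2norm_triangle_diff[OF s[OF that(3)] s[OF K(2)] s[OF that(6)], of N] K(3)[OF that(1-3)] K(3)[OF that(4-6)]
      l2norm_minus_commute[of M "s (K N)" "s J'"] by simp
  obtain w where w: "w \<in> L2 M" and wlim: "(\<lambda>n. l2norm M (\<lambda>x. s (L n) x - w x)) \<longlonglongrightarrow> 0"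
  proof (rule l2_complete)
    show "s (L n) \<in> L2 M" for n by (rule s[OF L(2)])
    fix \<epsilon> :: real assume "\<epsilon> > 0"
    then obtain N where "1 / real (Suc N) < \<epsilon> / 2" using nat_approx_posE[of "\<epsilon> / 2"] by auto
    then have N: "2 / real (Suc N) < \<epsilon>" by simp
    show "\<exists>N. \<forall>m\<ge>N. \<forall>n\<ge>N. l2norm M (\<lambda>x. s (L m) x - s (L n) x) < \<epsilon>"
      using close[OF L(1) L(3) L(2) L(1) L(3) L(2)] N less_trans by blast
  qed
  have "((\<lambda>J. l2norm M (\<lambda>x. s J x - w x)) \<longlongrightarrow> 0) (finite_subsets_at_top I)"
  proof (rule tendstoI)
    fix \<epsilon> :: real assume "\<epsilon> > 0"
    \<comment> \<open>Two thirds go to comparing \<open>s J\<close> with \<open>s (L n)\<close>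
      through \<open>s (K N)\<close>, the last to the distance of \<open>s (L n)\<close> from
      \<open>w\<close>.\<close>
    then obtain N where "1 / real (Suc N) < \<epsilon> / 3" using nat_approx_posE[of "\<epsilon> / 3"] by auto
    then have N: "3 / real (Suc N) < \<epsilon>" by simp
    obtain n0 where n0: "\<And>n. n \<ge> n0 \<Longrightarrow> l2norm M (\<lambda>x. s (L n) x - w x) < 1 / real (Suc N)"
      using LIMSEQ_D[OF wlim, of "1 / real (Suc N)"] by (auto simp: l2norm_nonneg)
    define n where "n = max n0 N"
    have "l2norm M (\<lambda>x. s J x - w x) < \<epsilon>" if J: "finite J" "K N \<subseteq> J" "J \<subseteq> I" for J
      using l2norm_triangle_diff[OF s[OF J(3)] s[OF L(2)] w, of n] close[OF J L(1) L(3) L(2), of n]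
        n0[of n] N by (simp add: n_def)
    then show "\<forall>\<^sub>F J in finite_subsets_at_top I. dist (l2norm M (\<lambda>x. s J x - w x)) 0 < \<epsilon>"
      unfolding eventually_finite_subsets_at_top using K(1,2)
      by (intro exI[of _ "K N"]) (simp add: l2norm_nonneg)
  qed
  with w show ?thesis unfolding s_def by blast
qed

section \<open>Orthonormality of the Gaussian coordinates\<close>

lemma gauss_coordinate_measurable: "i \<in> I \<Longrightarrow> (\<lambda>\<omega>. \<omega> i) \<in> borel_measurable (gauss I)"
  using measurable_component_singleton[of i I "\<lambda>_. std_normal_distribution"]
  by (simp add: gauss_def cong: measurable_cong_sets)

lemma distr_gauss_coordinate:
  assumes "i \<in> I"
  shows "distr (gauss I) borel (\<lambda>\<omega>. \<omega> i) = std_normal_distribution"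
proof -
  have "distr (gauss I) borel (\<lambda>\<omega>. \<omega> i) = distr (gauss I) std_normal_distribution (\<lambda>\<omega>. \<omega> i)"
    by (intro distr_cong) auto
  then show ?thesis
    using assms distr_PiM_component[of I "\<lambda>_. std_normal_distribution" i]
    by (simp add: gauss_def prob_space_normal_density)
qed

lemma gauss_coordinate_sq:
  assumes "i \<in> I"
  shows "integrable (gauss I) (\<lambda>\<omega>. (\<omega> i)\<^sup>2)" "(LINT \<omega>|gauss I. (\<omega> i)\<^sup>2) = 1"
proof -
  note [measurable] = gauss_coordinate_measurable[OF assms]
  have "integrable (distr (gauss I) borel (\<lambda>\<omega>. \<omega> i)) (\<lambda>x. x\<^sup>2)"
    using std_normal_distribution_even_moments(2)[of 1] by (simp add: distr_gauss_coordinate[OF assms])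
  then show "integrable (gauss I) (\<lambda>\<omega>. (\<omega> i)\<^sup>2)"
    by (subst (asm) integrable_distr_eq) auto
  have "(LINT x|distr (gauss I) borel (\<lambda>\<omega>. \<omega> i). x\<^sup>2) = 1"
    using std_normal_distribution_even_moments(1)[of 1] by (simp add: distr_gauss_coordinate[OF assms])
  then show "(LINT \<omega>|gauss I. (\<omega> i)\<^sup>2) = 1"
    by (subst (asm) integral_distr) auto
qed

text \<open>Only two coordinates enter, so the integral is pushed to the finite product over them,
  where it factors into two vanishing means.\<close>

lemma gauss_coordinate_mult:
  assumes "i \<in> I" "j \<in> I" "i \<noteq> j"
  shows "(LINT \<omega>|gauss I. \<omega> i * \<omega> j) = 0"
proof -
  let ?N = "\<lambda>_ :: 'a. std_normal_distribution" and ?J = "{i, j}"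
  interpret product_prob_space ?N I
    by (simp add: product_prob_spaceI prob_space_normal_density)
  have restr: "(\<lambda>\<omega>. restrict \<omega> ?J) \<in> measurable (PiM I ?N) (PiM ?J ?N)"
    using assms by (intro measurable_restrict_subset) auto
  have [measurable]: "(\<lambda>\<omega>. \<omega> i * \<omega> j) \<in> borel_measurable (PiM ?J ?N)"
    using gauss_coordinate_measurable[of i ?J] gauss_coordinate_measurable[of j ?J]
    by (simp add: gauss_def)
  have "(LINT \<omega>|gauss I. \<omega> i * \<omega> j) = (LINT \<omega>|PiM I ?N. restrict \<omega> ?J i * restrict \<omega> ?J j)"
    by (simp add: gauss_def)
  also have "\<dots> = (LINT \<omega>|distr (PiM I ?N) (PiM ?J ?N) (\<lambda>\<omega>. restrict \<omega> ?J). \<omega> i * \<omega> j)"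
    by (rule integral_distr[OF restr, symmetric]) measurable
  also have "\<dots> = (LINT \<omega>|PiM ?J ?N. (\<Prod>k\<in>?J. \<omega> k))"
    using assms by (subst distr_PiM_restrict_finite) auto
  also have "\<dots> = (\<Prod>k\<in>?J. (LINT x|std_normal_distribution. x))"
    using integrable_std_normal_moment[of 1]
    by (subst product_integral_prod) (auto simp: integrable_density)
  also have "\<dots> = 0"
    using assms integral_std_normal_distribution_moment_odd[of 1] by simp
  finally show ?thesis .
qed

lemma gauss_coordinate_L2:
  assumes "i \<in> I"
  shows "(\<lambda>\<omega>. complex_of_real (\<omega> i)) \<in> L2 (gauss I)"
  using gauss_coordinate_measurable[OF assms] gauss_coordinate_sq(1)[OF assms]
  by (simp add: L2_def)

lemma gauss_coordinates_orthonormal: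
  assumes "i \<in> I" "j \<in> I"
  shows "l2inner (gauss I) (\<lambda>\<omega>. complex_of_real (\<omega> i)) (\<lambda>\<omega>. complex_of_real (\<omega> j)) = (if i = j then 1 else 0)"
proof -
  have "l2inner (gauss I) (\<lambda>\<omega>. complex_of_real (\<omega> i)) (\<lambda>\<omega>. complex_of_real (\<omega> j))
      = complex_of_real (LINT \<omega>|gauss I. \<omega> i * \<omega> j)"
    by (simp add: l2inner_def flip: of_real_mult integral_complex_of_real)
  then show ?thesis
    using gauss_coordinate_mult[OF assms] gauss_coordinate_sq(2)[OF assms(1)]
    by (auto simp: power2_eq_square)
qed

section \<open>Brownian motions and Ito isometries\<close>

text \<open>Orthonormality gives Bessel's inequality and hence convergence of the series; real
  classes give real coefficients for real functions, hence real Brownian motions.\<close>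

locale real_orthonormal_family =
  fixes S :: "'a measure" and I :: "'i set" and e :: "'i \<Rightarrow> 'a uvec"
  assumes real_class: "i \<in> I \<Longrightarrow> real_class S (e i)"
    and orthonormal: "i \<in> I \<Longrightarrow> j \<in> I \<Longrightarrow> uinner S (e i) (e j) = (if i = j then 1 else 0)"
begin

definition coeff :: "'a measure \<Rightarrow> ('a \<Rightarrow> complex) \<Rightarrow> 'i \<Rightarrow> complex" where
  "coeff \<mu> f i = uinner S (uclass S f \<mu>) (e i)"

definition partial_sum :: "'a measure \<Rightarrow> ('a \<Rightarrow> complex) \<Rightarrow> 'i set \<Rightarrow> ('i \<Rightarrow> real) \<Rightarrow> complex" where
  "partial_sum \<mu> f J \<omega> = (\<Sum>i\<in>J. coeff \<mu> f i * complex_of_real (\<omega> i))"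

definition white_noise :: "'a measure \<Rightarrow> ('a \<Rightarrow> complex) \<Rightarrow> ('i \<Rightarrow> real) \<Rightarrow> complex" where
  "white_noise \<mu> f = W S I e (uclass S f \<mu>)"

lemma Bessel:
  assumes "finite J" "J \<subseteq> I" "sfm S \<mu>" "f \<in> L2 \<mu>"
  shows "(\<Sum>i\<in>J. (cmod (coeff \<mu> f i))\<^sup>2) \<le> (l2norm \<mu> f)\<^sup>2"
  unfolding coeff_def
  by (intro uinner_Bessel assms(1,3,4)) (simp_all add: subsetD[OF assms(2)] real_class orthonormal)

lemma eventually_finite_subset: "\<forall>\<^sub>F J in finite_subsets_at_top I. finite J \<and> J \<subseteq> I"
  by (simp add: eventually_finite_subsets_at_top) blast

lemma partial_sum_L2: "J \<subseteq> I \<Longrightarrow> partial_sum \<mu> f J \<in> L2 (gauss I)"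
  unfolding partial_sum_def[abs_def] by (intro L2_sum gauss_coordinate_L2) auto

lemma eventually_partial_sum_L2:
  "\<forall>\<^sub>F J in finite_subsets_at_top I. partial_sum \<mu> f J \<in> L2 (gauss I)"
  using eventually_finite_subset by (rule eventually_mono) (simp add: partial_sum_L2)

text \<open>Bessel's inequality bounds the coefficient sums by the squared norm of \<open>f\<close>,
  so the series converges and the choice in \<open>W\<close> really picks a limit.\<close>

lemma white_noise:
  assumes "sfm S \<mu>" "f \<in> L2 \<mu>"
  shows white_noise_L2: "white_noise \<mu> f \<in> L2 (gauss I)"
    and white_noise_limit: "((\<lambda>J. l2norm (gauss I) (\<lambda>\<omega>. partial_sum \<mu> f J \<omega> - white_noise \<mu> f \<omega>)) \<longlongrightarrow> 0)
      (finite_subsets_at_top I)"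
proof -
  have "\<exists>w. w \<in> L2 (gauss I) \<and>
      ((\<lambda>J. l2norm (gauss I) (\<lambda>\<omega>. (\<Sum>i\<in>J. coeff \<mu> f i * complex_of_real (\<omega> i)) - w \<omega>)) \<longlongrightarrow> 0)
        (finite_subsets_at_top I)"
    by (rule l2_orthonormal_series[where B = "(l2norm \<mu> f)\<^sup>2"])
       (auto intro: gauss_coordinate_L2 Bessel assms simp: gauss_coordinates_orthonormal)
  from someI_ex[OF this]
  show "white_noise \<mu> f \<in> L2 (gauss I)"
    "((\<lambda>J. l2norm (gauss I) (\<lambda>\<omega>. partial_sum \<mu> f J \<omega> - white_noise \<mu> f \<omega>)) \<longlongrightarrow> 0)
      (finite_subsets_at_top I)"
    unfolding white_noise_def W_def partial_sum_def coeff_def by auto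
qed

text \<open>Parseval on the Gaussian side and Bessel on the universal side bound every partial sum;
  continuity of the norm passes this to the limit.\<close>

lemma white_noise_norm:
  assumes "sfm S \<mu>" "f \<in> L2 \<mu>"
  shows "l2norm (gauss I) (white_noise \<mu> f) \<le> l2norm \<mu> f"
proof (rule tendsto_upperbound)
  show "((\<lambda>J. l2norm (gauss I) (partial_sum \<mu> f J)) \<longlongrightarrow> l2norm (gauss I) (white_noise \<mu> f))
      (finite_subsets_at_top I)"
    by (rule l2norm_tendsto[OF eventually_partial_sum_L2 white_noise[OF assms]])
  have "l2norm (gauss I) (partial_sum \<mu> f J) \<le> l2norm \<mu> f" if "finite J \<and> J \<subseteq> I" for J
  proof (rule power2_le_imp_le)
    have "(l2norm (gauss I) (partial_sum \<mu> f J))\<^sup>2 = (\<Sum>i\<in>J. (cmod (coeff \<mu> f i))\<^sup>2)"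
      unfolding partial_sum_def[abs_def] using that
      by (intro l2_Parseval_finite gauss_coordinate_L2 gauss_coordinates_orthonormal) auto
    also have "\<dots> \<le> (l2norm \<mu> f)\<^sup>2" using that assms by (intro Bessel) auto
    finally show "(l2norm (gauss I) (partial_sum \<mu> f J))\<^sup>2 \<le> (l2norm \<mu> f)\<^sup>2" .
  qed (rule l2norm_nonneg)
  then show "\<forall>\<^sub>F J in finite_subsets_at_top I. l2norm (gauss I) (partial_sum \<mu> f J) \<le> l2norm \<mu> f"
    using eventually_finite_subset by (rule eventually_mono[rotated])
qed simp

lemma coeff_lincomb:
  assumes "sfm S \<mu>" "f \<in> L2 \<mu>" "g \<in> L2 \<mu>" "i \<in> I"
  shows "coeff \<mu> (\<lambda>x. a * f x + b * g x) i = a * coeff \<mu> f i + b * coeff \<mu> g i"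
proof -
  obtain h \<kappa> where "(h, \<kappa>) \<in> upairs S" "e i = uclass S h \<kappa>"
    using real_class[OF assms(4)] by (auto simp: real_class_def)
  then show ?thesis
    unfolding coeff_def using uinner_uclass_lincomb[OF assms(1-3)] by simp
qed

text \<open>The versions are chosen separately for each class, so equality can only hold almost
  everywhere: both sides are limits of the same partial sums.\<close>

lemma white_noise_lincomb:
  assumes "sfm S \<mu>" "f \<in> L2 \<mu>" "g \<in> L2 \<mu>"
  shows "AE \<omega> in gauss I. white_noise \<mu> (\<lambda>x. a * f x + b * g x) \<omega> = a * white_noise \<mu> f \<omega> + b * white_noise \<mu> g \<omega>"
proof (rule l2_limit_unique)
  let ?G = "gauss I" and ?h = "\<lambda>x. a * f x + b * g x" and ?net = "finite_subsets_at_top I"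
  let ?w = "\<lambda>\<omega>. a * white_noise \<mu> f \<omega> + b * white_noise \<mu> g \<omega>"
  have h: "?h \<in> L2 \<mu>" using assms(2,3) by (rule L2_lincomb)
  show "\<forall>\<^sub>F J in ?net. partial_sum \<mu> ?h J \<in> L2 ?G" by (rule eventually_partial_sum_L2)
  show "white_noise \<mu> ?h \<in> L2 ?G" by (rule white_noise_L2[OF assms(1) h])
  show "?w \<in> L2 ?G" using white_noise_L2 assms by (intro L2_lincomb) auto
  show "((\<lambda>J. l2norm ?G (\<lambda>\<omega>. partial_sum \<mu> ?h J \<omega> - white_noise \<mu> ?h \<omega>)) \<longlongrightarrow> 0) ?net"
    by (rule white_noise_limit[OF assms(1) h])
  show "((\<lambda>J. l2norm ?G (\<lambda>\<omega>. partial_sum \<mu> ?h J \<omega> - ?w \<omega>)) \<longlongrightarrow> 0) ?net"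
  proof (rule Lim_null_comparison)
    let ?d = "\<lambda>f J \<omega>. partial_sum \<mu> f J \<omega> - white_noise \<mu> f \<omega>"
    show "((\<lambda>J. cmod a * l2norm ?G (?d f J) + cmod b * l2norm ?G (?d g J)) \<longlongrightarrow> 0) ?net"
      using tendsto_add[OF tendsto_mult_left[OF white_noise_limit[OF assms(1,2)], of "cmod a"]
          tendsto_mult_left[OF white_noise_limit[OF assms(1,3)], of "cmod b"]] by simp
    have "norm (l2norm ?G (\<lambda>\<omega>. partial_sum \<mu> ?h J \<omega> - ?w \<omega>)) \<le> cmod a * l2norm ?G (?d f J) + cmod b * l2norm ?G (?d g J)"
      if J: "finite J \<and> J \<subseteq> I" for J
    proof -
      have "partial_sum \<mu> ?h J \<omega> = a * partial_sum \<mu> f J \<omega> + b * partial_sum \<mu> g J \<omega>" for \<omega>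
        unfolding partial_sum_def sum_distrib_left sum.distrib[symmetric]
        using J coeff_lincomb[OF assms] by (intro sum.cong) (auto simp: algebra_simps)
      then have "(\<lambda>\<omega>. partial_sum \<mu> ?h J \<omega> - ?w \<omega>) = (\<lambda>\<omega>. a * ?d f J \<omega> + b * ?d g J \<omega>)"
        by (simp add: algebra_simps)
      moreover have "?d f J \<in> L2 ?G" "?d g J \<in> L2 ?G"
        using J assms by (simp_all add: L2_diff partial_sum_L2 white_noise_L2)
      ultimately show ?thesis
        using l2norm_triangle[of "\<lambda>\<omega>. a * ?d f J \<omega>" ?G "\<lambda>\<omega>. b * ?d g J \<omega>"]
        by (simp only: L2_scale l2norm_scale real_norm_def abs_of_nonneg[OF l2norm_nonneg])
    qed
    then show "\<forall>\<^sub>F J in ?net. norm (l2norm ?G (\<lambda>\<omega>. partial_sum \<mu> ?h J \<omega> - ?w \<omega>))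
        \<le> cmod a * l2norm ?G (?d f J) + cmod b * l2norm ?G (?d g J)"
      using eventually_finite_subset by (rule eventually_mono[rotated])
  qed
qed simp

text \<open>The partial sums are real, so conjugation preserves their distance to the limit and the
  conjugate is a limit as well.\<close>

lemma white_noise_real:
  assumes "sfm S \<mu>" "f \<in> L2 \<mu>" "\<And>x. f x \<in> \<real>"
  shows "AE \<omega> in gauss I. cnj (white_noise \<mu> f \<omega>) = white_noise \<mu> f \<omega>"
proof (rule l2_limit_unique)
  let ?G = "gauss I" and ?net = "finite_subsets_at_top I"
  show "\<forall>\<^sub>F J in ?net. partial_sum \<mu> f J \<in> L2 ?G" by (rule eventually_partial_sum_L2)
  show "white_noise \<mu> f \<in> L2 ?G" "(\<lambda>\<omega>. cnj (white_noise \<mu> f \<omega>)) \<in> L2 ?G"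
    using white_noise_L2[OF assms(1,2)] by (simp_all add: L2_cnj)
  show *: "((\<lambda>J. l2norm ?G (\<lambda>\<omega>. partial_sum \<mu> f J \<omega> - white_noise \<mu> f \<omega>)) \<longlongrightarrow> 0) ?net"
    by (rule white_noise_limit[OF assms(1,2)])
  have real: "cnj (coeff \<mu> f i) = coeff \<mu> f i" if i: "i \<in> I" for i
  proof -
    obtain h \<kappa> where "(h, \<kappa>) \<in> upairs S" "\<And>x. x \<in> space S \<Longrightarrow> h x \<in> \<real>" "e i = uclass S h \<kappa>"
      using real_class[OF i] by (auto simp: real_class_def)
    then show ?thesis
      unfolding coeff_def using uinner_real[of f \<mu> S h \<kappa>] assms by (simp add: upairs_def)
  qed
  have eq: "l2norm ?G (\<lambda>\<omega>. partial_sum \<mu> f J \<omega> - white_noise \<mu> f \<omega>)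
      = l2norm ?G (\<lambda>\<omega>. partial_sum \<mu> f J \<omega> - cnj (white_noise \<mu> f \<omega>))" if J: "finite J \<and> J \<subseteq> I" for J
  proof -
    have "partial_sum \<mu> f J \<omega> = cnj (partial_sum \<mu> f J \<omega>)" for \<omega>
      unfolding partial_sum_def using J real by (auto intro!: sum.cong)
    then have "partial_sum \<mu> f J \<omega> - cnj (white_noise \<mu> f \<omega>) = cnj (partial_sum \<mu> f J \<omega> - white_noise \<mu> f \<omega>)" for \<omega>
      by simp
    then show ?thesis by (simp only: l2norm_def complex_mod_cnj)
  qed
  show "((\<lambda>J. l2norm ?G (\<lambda>\<omega>. partial_sum \<mu> f J \<omega> - cnj (white_noise \<mu> f \<omega>))) \<longlongrightarrow> 0) ?net"
    by (rule Lim_transform_eventually[OF *])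
       (rule eventually_mono[OF eventually_finite_subset eq])
qed simp

lemma white_noise_continuous_linear:
  assumes \<mu>: "sfm S \<mu>"
  shows "l2_continuous_linear \<mu> (gauss I) (white_noise \<mu>)"
  unfolding l2_continuous_linear_def
proof (intro conjI ballI allI impI)
  show "white_noise \<mu> f \<in> L2 (gauss I)" if "f \<in> L2 \<mu>" for f
    by (rule white_noise_L2[OF \<mu> that])
  show "AE \<omega> in gauss I. white_noise \<mu> (\<lambda>x. a * f x + b * g x) \<omega> = a * white_noise \<mu> f \<omega> + b * white_noise \<mu> g \<omega>"
    if "f \<in> L2 \<mu>" "g \<in> L2 \<mu>" for f g a b
    by (rule white_noise_lincomb[OF \<mu> that])
  fix F :: "nat \<Rightarrow> 'a \<Rightarrow> complex" and f
  assume F: "\<forall>n. F n \<in> L2 \<mu>" and f: "f \<in> L2 \<mu>" and lim: "(\<lambda>n. l2norm \<mu> (\<lambda>x. F n x - f x)) \<longlonglongrightarrow> 0"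
  have "l2norm (gauss I) (\<lambda>\<omega>. white_noise \<mu> (F n) \<omega> - white_noise \<mu> f \<omega>) \<le> l2norm \<mu> (\<lambda>x. F n x - f x)" for n
  proof -
    have L2: "F n \<in> L2 \<mu>" "(\<lambda>x. F n x - f x) \<in> L2 \<mu>" using F f by (simp_all add: L2_diff)
    have "AE \<omega> in gauss I. white_noise \<mu> (F n) \<omega> - white_noise \<mu> f \<omega> = white_noise \<mu> (\<lambda>x. F n x - f x) \<omega>"
      using white_noise_lincomb[OF \<mu> L2(1) f, of 1 "-1"] by (auto elim: eventually_mono)
    then have "l2norm (gauss I) (\<lambda>\<omega>. white_noise \<mu> (F n) \<omega> - white_noise \<mu> f \<omega>)
        = l2norm (gauss I) (white_noise \<mu> (\<lambda>x. F n x - f x))"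
      by (intro l2norm_cong_AE L2_measurable L2_diff white_noise_L2[OF \<mu>] L2 f)
    also have "\<dots> \<le> l2norm \<mu> (\<lambda>x. F n x - f x)" by (rule white_noise_norm[OF \<mu> L2(2)])
    finally show ?thesis .
  qed
  then show "(\<lambda>n. l2norm (gauss I) (\<lambda>\<omega>. white_noise \<mu> (F n) \<omega> - white_noise \<mu> f \<omega>)) \<longlonglongrightarrow> 0"
    by (intro Lim_null_comparison[OF _ lim] always_eventually) (simp add: l2norm_nonneg)
qed

section \<open>Brownian motions, the Ito map and its adjoint\<close>

lemma brownian_eq: "brownian S I e \<mu> A = white_noise \<mu> (indicator A)"
  by (simp add: brownian_def white_noise_def)

lemma brownian_L2: "sfm S \<mu> \<Longrightarrow> A \<in> Ffin \<mu> \<Longrightarrow> brownian S I e \<mu> A \<in> L2 (gauss I)"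
  unfolding brownian_eq by (intro white_noise_L2 L2_indicator)

lemma brownian_real:
  "sfm S \<mu> \<Longrightarrow> A \<in> Ffin \<mu> \<Longrightarrow> AE \<omega> in gauss I. cnj (brownian S I e \<mu> A \<omega>) = brownian S I e \<mu> A \<omega>"
  unfolding brownian_eq by (rule white_noise_real) (auto simp: L2_indicator indicator_def)

text \<open>\<open>white_noise \<mu>\<close> shows that the choice succeeds. The chosen map need not
  be that witness, so only these two properties are passed on.\<close>

lemma ito:
  assumes "sfm S \<mu>"
  shows ito_continuous_linear: "l2_continuous_linear \<mu> (gauss I) (ito S I e \<mu>)"
    and ito_indicator: "A \<in> Ffin \<mu> \<Longrightarrow> AE \<omega> in gauss I. ito S I e \<mu> (indicator A) \<omega> = brownian S I e \<mu> A \<omega>"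
proof -
  have "\<exists>V. l2_continuous_linear \<mu> (gauss I) V \<and>
      (\<forall>A\<in>Ffin \<mu>. AE \<omega> in gauss I. V (indicator A) \<omega> = brownian S I e \<mu> A \<omega>)"
    using white_noise_continuous_linear[OF assms] by (intro exI[of _ "white_noise \<mu>"]) (simp add: brownian_eq)
  from someI_ex[OF this, folded ito_def]
  show "l2_continuous_linear \<mu> (gauss I) (ito S I e \<mu>)"
    "A \<in> Ffin \<mu> \<Longrightarrow> AE \<omega> in gauss I. ito S I e \<mu> (indicator A) \<omega> = brownian S I e \<mu> A \<omega>"
    by auto
qed

text \<open>Both assertions of the theorem are instances, with the two measures exchanged.\<close>

lemma adjoint_ito_brownian:
  assumes \<mu>: "sfm S \<mu>" and \<nu>: "sfm S \<nu>" and B: "B \<in> Ffin \<nu>"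
  defines "R \<equiv> \<lambda>D. LINT \<omega>|gauss I. brownian S I e \<mu> D \<omega> * brownian S I e \<nu> B \<omega>"
  shows "R \<in> rkhs_measure \<mu>"
    and "AE x in \<mu>. l2adjoint \<mu> (gauss I) (ito S I e \<mu>) (brownian S I e \<nu> B) x = krein_feller \<mu> R x"
proof -
  let ?w = "brownian S I e \<nu> B"
  note V = ito_continuous_linear[OF \<mu>]
  have w: "?w \<in> L2 (gauss I)" by (rule brownian_L2[OF \<nu> B])
  note [measurable] = L2_measurable[OF w]
  have R: "R D = l2inner (gauss I) (ito S I e \<mu> (indicator D)) ?w" if D: "D \<in> Ffin \<mu>" for D
  proof -
    note [measurable] = L2_measurable[OF brownian_L2[OF \<mu> D]]
    have "ito S I e \<mu> (indicator D) \<in> L2 (gauss I)"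
      using V L2_indicator[OF D] by (simp add: l2_continuous_linear_def)
    note [measurable] = L2_measurable[OF this]
    show ?thesis unfolding R_def l2inner_def
    proof (rule integral_cong_AE)
      \<comment> \<open>The expectation has no conjugate but the inner product does; realness of the
        second Brownian motion bridges the two.\<close>
      show "AE \<omega> in gauss I. brownian S I e \<mu> D \<omega> * ?w \<omega> = ito S I e \<mu> (indicator D) \<omega> * cnj (?w \<omega>)"
        using ito_indicator[OF \<mu> D] brownian_real[OF \<nu> B] by eventually_elim simp
    qed measurable
  qed
  have real: "cnj (R D) = R D" if D: "D \<in> Ffin \<mu>" for D
  proof -
    note [measurable] = L2_measurable[OF brownian_L2[OF \<mu> D]]
    have "cnj (R D) = (LINT \<omega>|gauss I. cnj (brownian S I e \<mu> D \<omega> * ?w \<omega>))"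
      unfolding R_def by (rule Bochner_Integration.integral_cnj[symmetric])
    also have "\<dots> = R D" unfolding R_def
    proof (rule integral_cong_AE)
      show "AE \<omega> in gauss I. cnj (brownian S I e \<mu> D \<omega> * ?w \<omega>) = brownian S I e \<mu> D \<omega> * ?w \<omega>"
        using brownian_real[OF \<mu> D] brownian_real[OF \<nu> B] by eventually_elim simp
    qed measurable
    finally show ?thesis .
  qed
  show "R \<in> rkhs_measure \<mu>"
    "AE x in \<mu>. l2adjoint \<mu> (gauss I) (ito S I e \<mu>) ?w x = krein_feller \<mu> R x"
    by (rule l2adjoint_eq_krein_feller[OF V w R real]; assumption)+
qed

end

theorem theorem5p4:
  fixes S \<mu>1 \<mu>2 :: "'a measure"
    and I :: "'i set" and e :: "'i \<Rightarrow> 'a uvec"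
  assumes "orthonormal_basis S I e" and "\<forall>i\<in>I. real_class S (e i)"
    and "sets \<mu>1 = sets S" and "sigma_finite_measure \<mu>1"
    and "sets \<mu>2 = sets S" and "sigma_finite_measure \<mu>2"
  shows "(\<forall>B\<in>Ffin \<mu>2.
            (\<lambda>D. LINT \<omega>|gauss I. brownian S I e \<mu>1 D \<omega> * brownian S I e \<mu>2 B \<omega>) \<in> rkhs_measure \<mu>1 \<and>
            (AE x in \<mu>1. l2adjoint \<mu>1 (gauss I) (ito S I e \<mu>1) (brownian S I e \<mu>2 B) x =
               krein_feller \<mu>1
                 (\<lambda>D. LINT \<omega>|gauss I. brownian S I e \<mu>1 D \<omega> * brownian S I e \<mu>2 B \<omega>) x)) \<and>
         (\<forall>A\<in>Ffin \<mu>1.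
            (\<lambda>D. LINT \<omega>|gauss I. brownian S I e \<mu>2 D \<omega> * brownian S I e \<mu>1 A \<omega>) \<in> rkhs_measure \<mu>2 \<and>
            (AE y in \<mu>2. l2adjoint \<mu>2 (gauss I) (ito S I e \<mu>2) (brownian S I e \<mu>1 A) y =
               krein_feller \<mu>2
                 (\<lambda>D. LINT \<omega>|gauss I. brownian S I e \<mu>2 D \<omega> * brownian S I e \<mu>1 A \<omega>) y))"
proof -
  interpret real_orthonormal_family S I e
    using assms(1,2) by unfold_locales (auto simp: orthonormal_basis_def)
  have "sfm S \<mu>1" "sfm S \<mu>2" using assms(3-6) by (auto simp: sfm_def)
  then show ?thesis using adjoint_ito_brownian by blast
qed

end
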